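(* Let $M=(M_n)_{n\ge0}$ be a log-convex sequence of positive numbers with $M_0=1$, let $\mu_n=M_n/M_{n-1}$ $(n\ge1)$ and $T_M(N)=\sum_{j\ge N}1/\mu_j$. Let $\psi\in\mathcal C_M([-1,1])$ be real-valued. (i) If $T_M(1)=\infty$, then $m_\psi(\lambda)=O(1)$ as $\lambda\to\infty$. (ii) Assume that $T_M(1)<\infty$ and that there is $C_0>1$ such that $\mu_NT_M(N)\ge C_0$ for all large $N$. Then there exist constants $C,c>0$ such that $$|m_\psi(\lambda)|\le C\Bigl(1+\log\frac1{T_M(c\log\lambda)}\Bigr)\qquad(\lambda\ge2).$$
   Context: For a real-valued $\psi\in C^1([-1,1])$ and $\lambda>0$, $m_\psi(\lambda):=\mathrm{p.v.}\int_{-1}^{1}e^{i\lambda\psi(t)}\frac{dt}{t}=\lim_{\varepsilon\to0^+}\int_{\varepsilon\le|t|\le1}e^{i\lambda\psi(t)}\frac{dt}{t}$. A positive sequence $M$ is log-convex if $M_n^2\le M_{n-1}M_{n+1}$ for all $n\ge1$. A function $\psi\in C^\infty([-1,1])$ belongs to the Denjoy--Carleman class $\mathcal C_M([-1,1])$ if there is a constant $K>0$ such that $\sup_{t\in[-1,1]}|\psi^{(n)}(t)|\le K^{n+1}M_n$ for all $n\ge0$. By convention $T_M(N)=\infty$ if the series diverges; for a real number $x>0$, $T_M(x)$ is the sum of $1/\mu_j$ over integers $j\ge1$ with $j\ge x$. The constants may depend on $\psi$ and $M$ but not on $\lambda$. *)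

theory Defs
  imports "HOL-Analysis.Analysis" "HOL-Library.Landau_Symbols"
begin

text \<open>
  Iterated derivatives relative to a set \<open>S\<close>; for \<open>S = {-1..1}\<close> the derivatives at the
  end points are one-sided, and only the values of \<open>f\<close> on \<open>S\<close> matter.
\<close>

primrec nth_deriv_within :: "real set \<Rightarrow> nat \<Rightarrow> (real \<Rightarrow> real) \<Rightarrow> real \<Rightarrow> real" where
  "nth_deriv_within S 0 f = f"
| "nth_deriv_within S (Suc n) f = (\<lambda>t. vector_derivative (nth_deriv_within S n f) (at t within S))"

definition C_infinity_on :: "real set \<Rightarrow> (real \<Rightarrow> real) \<Rightarrow> bool" where
  "C_infinity_on S f \<longleftrightarrow> (\<forall>n. nth_deriv_within S n f differentiable_on S)"

definition denjoy_carleman :: "(nat \<Rightarrow> real) \<Rightarrow> real set \<Rightarrow> (real \<Rightarrow> real) set" where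
  "denjoy_carleman M S =
     {f. C_infinity_on S f \<and>
         (\<exists>K>0. \<forall>n. \<forall>t\<in>S. \<bar>nth_deriv_within S n f t\<bar> \<le> K ^ (n + 1) * M n)}"

definition log_convex_seq :: "(nat \<Rightarrow> real) \<Rightarrow> bool" where
  "log_convex_seq M \<longleftrightarrow> (\<forall>n\<ge>1. (M n)\<^sup>2 \<le> M (n - 1) * M (n + 1))"

text \<open>Only meant for indices \<open>n \<ge> 1\<close>.\<close>

definition seq_ratio :: "(nat \<Rightarrow> real) \<Rightarrow> nat \<Rightarrow> real" where
  "seq_ratio M n = M n / M (n - 1)"

text \<open>The tail sum takes the value \<open>\<infinity>\<close> exactly when the series diverges.\<close>

definition tail_sum :: "(nat \<Rightarrow> real) \<Rightarrow> real \<Rightarrow> ennreal" where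
  "tail_sum M x = (\<Sum>\<^sub>\<infinity>j\<in>{j::nat. 1 \<le> j \<and> x \<le> real j}. ennreal (1 / seq_ratio M j))"

definition truncated_osc_integral :: "(real \<Rightarrow> real) \<Rightarrow> real \<Rightarrow> real \<Rightarrow> complex" where
  "truncated_osc_integral \<psi> lam \<epsilon> =
     integral {t. \<epsilon> \<le> \<bar>t\<bar> \<and> \<bar>t\<bar> \<le> 1}
       (\<lambda>t. exp (\<i> * complex_of_real (lam * \<psi> t)) / complex_of_real t)"

definition pv_osc_integral :: "(real \<Rightarrow> real) \<Rightarrow> real \<Rightarrow> complex" where
  "pv_osc_integral \<psi> lam = Lim (at_right 0) (truncated_osc_integral \<psi> lam)"

text \<open>
  The limit exists as soon as \<open>\<psi>\<close> is continuous on \<open>{-1..1}\<close> and differentiable at \<open>0\<close>, because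
  the truncated integral is the integral over \<open>{\<epsilon>..1}\<close> of a difference quotient that extends
  continuously to \<open>0\<close>.
\<close>

lemma truncated_osc_integral_tendsto:
  fixes \<psi> :: "real \<Rightarrow> real"
  assumes cont: "continuous_on {-1..1} \<psi>" and diff: "\<psi> differentiable (at 0)"
  shows "(truncated_osc_integral \<psi> lam \<longlongrightarrow> pv_osc_integral \<psi> lam) (at_right 0)"
proof -
  define e where "e t = exp (\<i> * complex_of_real (lam * \<psi> t))" for t
  define h0 where "h0 t = (e t - e (-t)) / complex_of_real t" for t
  have ce: "continuous_on {-1..1} e"
    unfolding e_def by (intro continuous_intros cont)
  have ce': "continuous_on {-1..1} (\<lambda>t. e (-t))"
    by (rule continuous_on_compose2[OF ce]) (auto intro!: continuous_intros)
  obtain D where D: "((\<lambda>t. e t - e (-t)) has_vector_derivative D) (at 0)"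
  proof -
    have 1: "(\<lambda>t. complex_of_real (lam * \<psi> t)) differentiable (at 0)"
      using diff by (intro differentiable_compose[OF bounded_linear_imp_differentiable[OF bounded_linear_of_real]] derivative_intros) auto
    have ee: "(\<lambda>z. exp (\<i> * z)) differentiable (at w)" for w :: complex
      by (rule field_differentiable_imp_differentiable)
         (auto simp: field_differentiable_def intro!: exI derivative_eq_intros)
    have 2: "e differentiable (at 0)"
      unfolding e_def using differentiable_compose[OF ee 1] by simp
    have 3: "(\<lambda>t. e (-t)) differentiable (at 0)"
      by (rule differentiable_compose[of e uminus]) (use 2 in auto)
    show ?thesis using that differentiable_diff[OF 2 3] by (meson vector_derivative_works)
  qed
  define h where "h = h0(0 := D)"
  have lim0: "(h0 \<longlongrightarrow> D) (at 0)"
  proof -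
    have "((\<lambda>t. norm ((e t - e (-t)) - t *\<^sub>R D) / norm t) \<longlongrightarrow> 0) (at 0)"
      using D unfolding has_vector_derivative_def has_derivative_iff_norm by simp
    moreover have "norm ((e t - e (-t)) - t *\<^sub>R D) / norm t = norm (h0 t - D)" if "t \<noteq> 0" for t
    proof -
      have "h0 t - D = ((e t - e (-t)) - t *\<^sub>R D) / complex_of_real t"
        using that by (simp add: h0_def scaleR_conv_of_real field_simps)
      then show ?thesis by (simp add: norm_divide)
    qed
    then have "eventually (\<lambda>t. norm ((e t - e (-t)) - t *\<^sub>R D) / norm t = norm (h0 t - D)) (at 0)"
      by (simp add: eventually_at_filter)
    ultimately have "((\<lambda>t. norm (h0 t - D)) \<longlongrightarrow> 0) (at 0)"
      by (rule Lim_transform_eventually)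
    then show ?thesis by (metis LIM_zero_cancel tendsto_norm_zero_cancel)
  qed
  have h0: "continuous_on {\<epsilon>..1} h0" if "0 < \<epsilon>" for \<epsilon>
    unfolding h0_def using that
    by (intro continuous_intros continuous_on_subset[OF ce] continuous_on_subset[OF ce']) auto
  have "(h \<longlongrightarrow> h x) (at x within {0..1})" if "x \<in> {0..1}" for x
  proof (cases "x = 0")
    case True
    have "(h \<longlongrightarrow> D) (at 0)"
      by (rule Lim_transform_eventually[OF lim0]) (auto simp: h_def eventually_at_filter)
    then show ?thesis using True by (auto simp: h_def intro: tendsto_within_subset)
  next
    case False
    then have x: "x \<in> {x/2<..}" "open {x/2<..}" "x / 2 > 0" "x \<in> {x/2..1}" using that by auto
    have "continuous_on {x/2..1} h"
      by (rule continuous_on_eq[OF h0[OF x(3)]]) (use x in \<open>auto simp: h_def\<close>)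
    then have "(h \<longlongrightarrow> h x) (at x within {x/2..1})"
      using x unfolding continuous_on_def by blast
    moreover have "at x within {x/2..1} = at x within {0..1}"
      by (rule at_within_nhd[OF x(1,2)]) (use x in auto)
    ultimately show ?thesis by simp
  qed
  then have ch: "continuous_on {0..1} h"
    by (simp add: continuous_on_def)
  have eq: "truncated_osc_integral \<psi> lam \<epsilon> = integral {\<epsilon>..1} h" if "0 < \<epsilon>" "\<epsilon> < 1" for \<epsilon>
  proof -
    define F where "F t = e t / complex_of_real t" for t
    have F1: "F integrable_on {\<epsilon>..1}" and F2: "F integrable_on {-1..-\<epsilon>}" 
      unfolding F_def using that
      by (auto intro!: integrable_continuous_real continuous_intros continuous_on_subset[OF ce])
    have F3: "(\<lambda>t. F (-t)) integrable_on {\<epsilon>..1}"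
      using F2 Henstock_Kurzweil_Integration.integrable_reflect_real[where f = F and a = "-1" and b = "-\<epsilon>"]
      by simp
    have "{t. \<epsilon> \<le> \<bar>t\<bar> \<and> \<bar>t\<bar> \<le> 1} = {-1..-\<epsilon>} \<union> {\<epsilon>..1}" using that by auto
    moreover have "{-1..-\<epsilon>} \<inter> {\<epsilon>..1} = {}" using that by auto
    ultimately have "truncated_osc_integral \<psi> lam \<epsilon> = integral {-1..-\<epsilon>} F + integral {\<epsilon>..1} F"
      unfolding truncated_osc_integral_def using F1 F2
      by (simp add: Henstock_Kurzweil_Integration.integral_Un F_def[abs_def] e_def[abs_def])
    also have "integral {-1..-\<epsilon>} F = integral {\<epsilon>..1} (\<lambda>t. F (-t))"
      using Henstock_Kurzweil_Integration.integral_reflect_real[where f = "\<lambda>t. F (-t)" and a = \<epsilon> and b = 1]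
      by simp
    also have "\<dots> + integral {\<epsilon>..1} F = integral {\<epsilon>..1} (\<lambda>t. F (-t) + F t)"
      using F1 F3 by (simp add: Henstock_Kurzweil_Integration.integral_add)
    also have "\<dots> = integral {\<epsilon>..1} h"
      by (rule Henstock_Kurzweil_Integration.integral_cong)
        (use that in \<open>auto simp: F_def h_def h0_def diff_divide_distrib\<close>)
    finally show ?thesis .
  qed
  have "((\<lambda>\<epsilon>. integral {\<epsilon>..1} h) \<longlongrightarrow> integral {0..1} h) (at 0 within {0..1})"
    using indefinite_integral_continuous_1'[OF integrable_continuous_real[OF ch]]
    by (auto simp: continuous_on_def)
  moreover have "at 0 within {0..1} = at_right (0::real)"
    by (simp add: at_within_Icc_at_right)
  ultimately have "((\<lambda>\<epsilon>. integral {\<epsilon>..1} h) \<longlongrightarrow> integral {0..1} h) (at_right 0)"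
    by simp
  moreover have "eventually (\<lambda>\<epsilon>. integral {\<epsilon>..1} h = truncated_osc_integral \<psi> lam \<epsilon>) (at_right 0)"
    using eventually_at_right_real[of 0 1] by (auto elim!: eventually_mono simp: eq)
  ultimately have "(truncated_osc_integral \<psi> lam \<longlongrightarrow> integral {0..1} h) (at_right 0)"
    by (rule Lim_transform_eventually)
  then show ?thesis
    unfolding pv_osc_integral_def by (metis tendsto_Lim trivial_limit_at_right_real)
qed

end

theory Submission
  imports Defs
begin

text \<open>
  The odd kernel \<open>1/t\<close> makes the integral of \<open>exp (i lam \<psi>) / t\<close> over \<open>\<epsilon> \<le> \<bar>t\<bar> \<le> 1\<close> equal to the
  integral over \<open>{\<epsilon>..1}\<close> of the difference of the oscillating factors at \<open>t\<close> and \<open>-t\<close>, divided by \<open>t\<close>.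
  If \<open>lam * \<bar>\<psi> t - \<psi> 0\<bar> \<le> C * (\<bar>t\<bar> / a) powr \<alpha>\<close> for \<open>\<bar>t\<bar> \<le> a\<close>, with some \<open>\<alpha> > 0\<close>,
  this difference is so small that the range \<open>\<bar>t\<bar> \<le> a\<close> contributes at most \<open>2 C / \<alpha>\<close>
  (\<open>norm_pv_osc_integral_le\<close>). Bounding the oscillating factors by \<open>1\<close> on the remaining range costs
  \<open>2 ln (1 / a)\<close>. Everything depends on how large the scale \<open>a\<close> can be taken for a given \<open>lam\<close>.
  
  If some derivative of \<open>\<psi>\<close> of positive order does not vanish at \<open>0\<close>, let \<open>k\<close> be the least such order. Then
  \<open>\<psi> t - \<psi> 0\<close> behaves like \<open>t ^ k\<close>, so \<open>a = lam powr (-1/k)\<close> is admissible. On \<open>a \<le> \<bar>t\<bar> \<le> \<delta>\<close> the phase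
  has no stationary point and one integration by parts gains the factor \<open>1 / (lam a ^ k) = 1\<close>. The integral
  is therefore bounded, whatever \<open>M\<close> is (\<open>finite_order_imp_bounded\<close>).
  
  If all derivatives of positive order vanish at \<open>0\<close>, Bang's argument applies. Call \<open>b\<close> a level at \<open>x\<close>
  if the \<open>n\<close>-th derivative at \<open>x\<close> is at most \<open>b exp n M n\<close> for every \<open>n\<close>. To raise the level from \<open>exp (-N)\<close> to
  \<open>exp (-(N - 1))\<close>, the point must move by at least \<open>1 / (e \<mu> N)\<close>. Starting from level \<open>0\<close> at the origin, the
  level is still at most \<open>exp (-N)\<close> at distance \<open>(1 / e)\<close> times the sum of \<open>1 / \<mu> j\<close> over \<open>j > N\<close>
  (\<open>bang_flat_bound\<close>). If the series diverges, \<open>\<psi>\<close> is constant near \<open>0\<close>: this is the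
  Denjoy--Carleman theorem, and the integral is bounded. If it converges, \<open>\<bar>\<psi> t - \<psi> 0\<bar>\<close> is of size \<open>exp (-N)\<close>
  for \<open>\<bar>t\<bar> \<le> \<kappa> T(N + 1)\<close>. The hypothesis \<open>\<mu> N T(N) \<ge> C\<^sub>0 > 1\<close> says that \<open>T(N + 1) \<ge> q T(N)\<close> with
  \<open>q = 1 - 1 / C\<^sub>0\<close>, so the exponential decay in \<open>N\<close> becomes a power of \<open>\<bar>t\<bar> / a\<close>, where
  \<open>a = \<kappa> T(N + 1)\<close> and \<open>N \<ge> ln lam\<close>. The logarithmic cost \<open>2 ln (1 / a)\<close> is the claimed bound.
  
  The constant \<open>c\<close> is chosen large rather than small: then \<open>T(c ln lam) \<le> 1\<close> already at \<open>lam = 2\<close>, which keeps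
  \<open>ln (1 / T(c ln lam))\<close> nonnegative, and \<open>c \<ge> 1\<close> gives \<open>lam exp (-N) \<le> 1\<close>.
\<close>

section \<open>Bang's propagation of smallness\<close>

locale log_convex_weights =
  fixes M :: "nat \<Rightarrow> real"
  assumes pos: "0 < M n" and lc: "log_convex_seq M"
begin

abbreviation \<mu> :: "nat \<Rightarrow> real" where "\<mu> \<equiv> seq_ratio M"

lemma ratio_pos: "0 < \<mu> n"
  using pos by (simp add: seq_ratio_def)

lemma ratio_mono:
  assumes "1 \<le> i" "i \<le> j"
  shows "\<mu> i \<le> \<mu> j"
  using \<open>i \<le> j\<close>
proof (induction j rule: dec_induct)
  case (step n)
  have "(M n)\<^sup>2 \<le> M (n - 1) * M (n + 1)"
    using lc step.hyps \<open>1 \<le> i\<close> by (auto simp: log_convex_seq_def)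
  then have "\<mu> n \<le> \<mu> (Suc n)"
    using pos[of n] pos[of "n - 1"]
    by (simp add: seq_ratio_def divide_simps power2_eq_square mult.commute)
  with step.IH show ?case by simp
qed simp

text \<open>
  Because the ratios increase, each derivative order below \<open>N\<close> costs at most a factor \<open>\<mu> N\<close>.
\<close>

lemma log_convex_growth:
  assumes "j + i \<le> N"
  shows "M (j + i) \<le> M j * \<mu> N ^ i"
  using \<open>j + i \<le> N\<close>
proof (induction i)
  case (Suc i)
  have "M (j + Suc i) = M (j + i) * \<mu> (Suc (j + i))"
    using pos[of "j + i"] by (simp add: seq_ratio_def)
  also have "\<dots> \<le> (M j * \<mu> N ^ i) * \<mu> N"
    using Suc ratio_mono[of "Suc (j + i)" N] pos[of "j + i"]
      ratio_pos[of N] ratio_pos[of "Suc (j+i)"] pos[of j]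
    by (intro mult_mono) auto
  finally show ?case by (simp add: mult_ac)
qed simp

text \<open>
  Taylor expansion of order \<open>N - n\<close> about \<open>x\<close>: the terms of total order below \<open>N\<close> are small by the hypothesis
  at \<open>x\<close>, and the remainder is small because the level \<open>b \<ge> exp (-N)\<close> makes the a priori bound \<open>M N\<close> at most
  \<open>b exp N M N\<close>. Since \<open>M (n + i) \<le> M n (\<mu> N) ^ i\<close>, the resulting bounds are terms of the exponential series of
  \<open>e (y - x) \<mu> N\<close>. For \<open>n \<ge> N\<close> the a priori bound alone suffices.
\<close>

lemma bang_step:
  fixes D :: "nat \<Rightarrow> real \<Rightarrow> real"
  assumes deriv: "\<And>n t. 0 \<le> t \<Longrightarrow> t < R \<Longrightarrow> (D n has_real_derivative D (Suc n) t) (at t)"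
    and bound: "\<And>n t. 0 \<le> t \<Longrightarrow> t < R \<Longrightarrow> \<bar>D n t\<bar> \<le> M n"
    and xy: "0 \<le> x" "x \<le> y" "y < R" and b: "exp (- real N) \<le> b"
    and small: "\<And>n. \<bar>D n x\<bar> \<le> b * exp (real n) * M n"
  shows "\<bar>D n y\<bar> \<le> b * exp (exp 1 * (y - x) * \<mu> N) * exp (real n) * M n"
proof -
  define E where "E = exp (exp 1 * (y - x) * \<mu> N)"
  have b0: "b > 0" using b by (meson exp_gt_zero less_le_trans)
  have E1: "E \<ge> 1" unfolding E_def using xy ratio_pos[of N] by simp
  consider "N \<le> n" | "n < N" "x = y" | "n < N" "x < y" using xy by linarith
  then show ?thesis
  proof cases
    case 1
    have "1 = exp (- real N) * exp (real N)" by (simp flip: exp_add)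
    also have "\<dots> \<le> (b * E) * exp (real n)"
      using b b0 E1 1 by (intro mult_mono) (auto intro: order_trans[OF b] simp: mult_le_cancel_left1)
    finally have "1 * M n \<le> (b * E) * exp (real n) * M n"
      using pos[of n] by (intro mult_right_mono) auto
    with bound[of y n] xy show ?thesis by (simp add: E_def)
  next
    case 2
    then show ?thesis using small[of n] by simp
  next
    case 3
    define m where "m = N - n"
    define h where "h = y - x"
    have m: "m > 0" "n + m = N" using 3 by (auto simp: m_def)
    have h: "h > 0" using 3 by (simp add: h_def)
    obtain \<xi> where \<xi>: "x < \<xi>" "\<xi> < y"
      and tay: "D n y = (\<Sum>i<m. D (n + i) x / fact i * h ^ i) + D (n + m) \<xi> / fact m * h ^ m"
      using Taylor_up[of m "\<lambda>i. D (n + i)" "D n" x y x] m 3 xy deriv by (auto simp: h_def)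
    define \<rho> where "\<rho> = exp 1 * h * \<mu> N"
    have \<rho>0: "0 \<le> \<rho>" using h ratio_pos[of N] by (simp add: \<rho>_def)
    have taylor_term: "\<bar>v / fact i * h ^ i\<bar> \<le> (b * exp (real n) * M n) * (\<rho> ^ i / fact i)"
      if "\<bar>v\<bar> \<le> b * exp (real (n + i)) * M (n + i)" "i \<le> m" for v i
    proof -
      have "\<bar>v\<bar> \<le> b * exp (real (n + i)) * (M n * \<mu> N ^ i)"
        using that log_convex_growth[of n i N] m b0
        by (elim order_trans) (auto intro!: mult_left_mono)
      also have "\<dots> = (b * exp (real n) * M n) * (exp 1 * \<mu> N) ^ i"
        by (simp add: exp_add power_mult_distrib exp_of_nat_mult[of _ 1, simplified])
      finally have "\<bar>v\<bar> * (h ^ i / fact i)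
          \<le> (b * exp (real n) * M n) * (exp 1 * \<mu> N) ^ i * (h ^ i / fact i)"
        using h by (intro mult_right_mono) auto
      then show ?thesis
        using h by (simp add: abs_mult \<rho>_def power_mult_distrib mult_ac)
    qed
    have last: "\<bar>D (n + m) \<xi>\<bar> \<le> b * exp (real (n + m)) * M (n + m)"
    proof -
      have "1 \<le> b * exp (real N)"
        using mult_right_mono[OF b, of "exp (real N)"] by (simp flip: exp_add)
      then have "1 * M N \<le> b * exp (real N) * M N"
        using pos[of N] by (intro mult_right_mono) auto
      with bound[of \<xi> N] \<xi> xy m show ?thesis by simp
    qed
    have "\<bar>D n y\<bar> \<le> (\<Sum>i<m. \<bar>D (n + i) x / fact i * h ^ i\<bar>) + \<bar>D (n + m) \<xi> / fact m * h ^ m\<bar>"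
      unfolding tay by (intro order_trans[OF abs_triangle_ineq] add_right_mono sum_abs)
    also have "\<dots> \<le> (\<Sum>i<m. (b * exp (real n) * M n) * (\<rho> ^ i / fact i))
        + (b * exp (real n) * M n) * (\<rho> ^ m / fact m)"
      by (intro add_mono sum_mono taylor_term small last) auto
    also have "\<dots> = (b * exp (real n) * M n) * (\<Sum>i<Suc m. \<rho> ^ i / fact i)"
      by (simp add: sum_distrib_left distrib_left)
    also have "(\<Sum>i<Suc m. \<rho> ^ i / fact i) \<le> exp \<rho>"
    proof -
      have "(\<Sum>i<Suc m. \<rho> ^ i / fact i) \<le> (\<Sum>i. \<rho> ^ i / fact i)"
        using \<rho>0 summable_exp[of \<rho>] by (intro sum_le_suminf) (auto simp: divide_inverse mult.commute)
      then show ?thesis by (simp add: exp_def divide_inverse mult.commute)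
    qed
    finally show ?thesis
      using b0 pos[of n] by (simp add: \<rho>_def h_def mult_ac mult_left_mono)
  qed
qed

text \<open>
  Downward induction on the level: from \<open>exp (-L)\<close>, which is trivially a level at the flat point \<open>0\<close>, each
  stretch of length \<open>1 / (e \<mu> j)\<close> multiplies the level by at most \<open>e\<close>. The starting index \<open>L\<close> is arbitrary, so
  only the partial sums of \<open>1 / \<mu> j\<close> limit the distance.
\<close>

lemma bang_flat_bound:
  fixes D :: "nat \<Rightarrow> real \<Rightarrow> real"
  assumes deriv: "\<And>n t. 0 \<le> t \<Longrightarrow> t < R \<Longrightarrow> (D n has_real_derivative D (Suc n) t) (at t)"
    and bound: "\<And>n t. 0 \<le> t \<Longrightarrow> t < R \<Longrightarrow> \<bar>D n t\<bar> \<le> M n"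
    and flat: "\<And>n. D n 0 = 0"
    and "N \<le> L" "0 \<le> x" "x < R" "x \<le> (\<Sum>j\<in>{N<..L}. 1 / \<mu> j) / exp 1"
  shows "\<bar>D n x\<bar> \<le> exp (- real N) * exp (real n) * M n"
  using \<open>N \<le> L\<close> \<open>0 \<le> x\<close> \<open>x < R\<close> \<open>x \<le> _\<close>
proof (induction N arbitrary: x n rule: inc_induct)
  case base
  then have "x = 0" by simp
  then show ?case using pos[of n] by (simp add: flat)
next
  case (step N)
  define s where "s = (\<Sum>j\<in>{Suc N<..L}. 1 / \<mu> j) / exp 1"
  \<comment> \<open>The part of the segment up to \<open>s\<close> is covered by the induction hypothesis; the rest is one step.\<close>
  define u where "u = min x s"
  have s0: "0 \<le> s"
    unfolding s_def using ratio_pos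
    by (intro divide_nonneg_pos sum_nonneg) (auto simp: less_imp_le)
  have u: "0 \<le> u" "u \<le> x" "u \<le> s" "u < R" using step.prems s0 by (auto simp: u_def)
  have "{N<..L} = insert (Suc N) {Suc N<..L}" using step.hyps by auto
  then have "x \<le> s + 1 / \<mu> (Suc N) / exp 1"
    using step.prems by (simp add: s_def add_divide_distrib)
  then have "x - u \<le> 1 / \<mu> (Suc N) / exp 1"
    using s0 ratio_pos[of "Suc N"] by (auto simp: u_def min_def)
  then have xu: "exp 1 * (x - u) * \<mu> (Suc N) \<le> 1"
    using ratio_pos[of "Suc N"] by (simp add: field_simps)
  have "\<bar>D n x\<bar> \<le> exp (- real (Suc N)) * exp (exp 1 * (x - u) * \<mu> (Suc N))
      * exp (real n) * M n"
    using step.IH[of u] u step.prems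
    by (intro bang_step[OF deriv bound, where R = R]) (auto simp: s_def)
  also have "\<dots> \<le> exp (- real (Suc N)) * exp 1 * exp (real n) * M n"
    using xu pos[of n] by (intro mult_right_mono mult_left_mono) auto
  also have "\<dots> = exp (- real N) * exp (real n) * M n"
    by (simp flip: exp_add)
  finally show ?case .
qed

section \<open>Tails of the reciprocal ratios\<close>

lemma tail_sum_nat_ceiling: "0 < x \<Longrightarrow> tail_sum M x = tail_sum M (real (nat \<lceil>x\<rceil>))"
proof -
  assume "0 < x"
  have "x \<le> real j \<longleftrightarrow> real (nat \<lceil>x\<rceil>) \<le> real j" for j
    using ceiling_le_iff[of x "int j"] by (simp add: nat_le_iff)
  then show ?thesis unfolding tail_sum_def by simp
qed

lemma tail_sum_suminf:
  assumes "1 \<le> N"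
  shows "tail_sum M (real N) = (\<Sum>i. ennreal (1 / \<mu> (i + N)))"
proof -
  have "{j::nat. 1 \<le> j \<and> real N \<le> real j} = (\<lambda>i. i + N) ` UNIV"
    using assms by (auto simp: image_iff intro: le_add_diff_inverse2[symmetric])
  then have "tail_sum M (real N) = infsum (\<lambda>i. ennreal (1 / \<mu> (i + N))) UNIV"
    by (simp add: tail_sum_def infsum_reindex o_def)
  moreover have "(\<lambda>i. ennreal (1 / \<mu> (i + N))) summable_on UNIV"
    by (rule nonneg_summable_on_complete) simp
  ultimately show ?thesis
    using has_sum_imp_sums[OF has_sum_infsum] sums_unique by metis
qed

lemma sum_ratio_shift: "(\<Sum>i<n. 1 / \<mu> (i + Suc N)) = (\<Sum>j\<in>{N<..N + n}. 1 / \<mu> j)"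
  by (rule sum.reindex_bij_witness[of _ "\<lambda>j. j - Suc N" "\<lambda>i. i + Suc N"]) auto

text \<open>
  The form in which divergence enters: Bang's distance is unlimited at every level.
\<close>

lemma divergent_ratio_sum:
  assumes "tail_sum M 1 = \<infinity>"
  obtains L where "N \<le> L" "B \<le> (\<Sum>j\<in>{N<..L}. 1 / \<mu> j)"
proof -
  have "\<not> summable (\<lambda>i. 1 / \<mu> (i + 1))"
  proof
    assume "summable (\<lambda>i. 1 / \<mu> (i + 1))"
    then have "(\<Sum>i. ennreal (1 / \<mu> (i + 1))) \<noteq> top"
      using ratio_pos by (intro ennreal_suminf_neq_top) (auto simp: less_imp_le)
    with assms tail_sum_suminf[of 1] show False by simp
  qed
  then have "\<not> summable (\<lambda>i. 1 / \<mu> (i + Suc N))"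
    using summable_iff_shift[of "\<lambda>i. 1 / \<mu> (i + 1)" N] by (simp add: add.commute add.left_commute)
  then have "\<not> (\<forall>n. (\<Sum>i<n. 1 / \<mu> (i + Suc N)) \<le> B)"
    using summableI_nonneg_bounded[of "\<lambda>i. 1 / \<mu> (i + Suc N)" B] ratio_pos
    by (auto simp del: add_Suc_right simp: less_imp_le)
  then obtain n where "B < (\<Sum>i<n. 1 / \<mu> (i + Suc N))"
    by (auto simp: not_le)
  then show ?thesis
    using that[of "N + n"] sum_ratio_shift[of N n] by (simp del: add_Suc_right)
qed

text \<open>
  A real-valued tail sum; it agrees with \<open>tail_sum\<close> when the series converges and \<open>N \<ge> 1\<close>.
\<close>

definition rest :: "nat \<Rightarrow> real" where
  "rest N = (\<Sum>i. 1 / \<mu> (i + N))"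

context
  assumes finite_tail: "tail_sum M 1 < \<infinity>"
begin

lemma summable_ratio:
  assumes "1 \<le> N"
  shows "summable (\<lambda>i. 1 / \<mu> (i + N))"
proof -
  have "(\<Sum>i. ennreal (1 / \<mu> (i + 1))) \<noteq> top"
    using finite_tail tail_sum_suminf[of 1] by simp
  then have "summable (\<lambda>i. 1 / \<mu> (i + 1))"
    by (rule summable_suminf_not_top[rotated]) (simp add: ratio_pos less_imp_le)
  then have "summable (\<lambda>i. 1 / \<mu> (i + (N - 1) + 1))"
    by (rule summable_ignore_initial_segment)
  moreover have "i + (N - 1) + 1 = i + N" for i
    using assms by simp
  ultimately show ?thesis by simp
qed

lemma rest_Suc: "1 \<le> N \<Longrightarrow> rest N = 1 / \<mu> N + rest (Suc N)"
  using suminf_split_head[OF summable_ratio, of N] by (simp add: rest_def)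

lemma rest_pos: "1 \<le> N \<Longrightarrow> 0 < rest N"
  unfolding rest_def by (intro suminf_pos summable_ratio) (simp_all add: ratio_pos)

lemma rest_antimono:
  assumes "1 \<le> N" "N \<le> N'"
  shows "rest N' \<le> rest N"
  using \<open>N \<le> N'\<close>
proof (induction N' rule: dec_induct)
  case (step n)
  then show ?case
    using rest_Suc[of n] ratio_pos[of n] \<open>1 \<le> N\<close> by (auto intro: order_trans[rotated])
qed simp

lemma tail_sum_eq_rest: "1 \<le> N \<Longrightarrow> tail_sum M (real N) = ennreal (rest N)"
  unfolding rest_def
  by (subst tail_sum_suminf) (auto intro!: suminf_ennreal2 summable_ratio simp: ratio_pos less_imp_le)

lemma rest_tendsto_0: "rest \<longlonglongrightarrow> 0"
proof -
  have "(\<lambda>n. \<Sum>i. 1 / \<mu> (i + n + 1)) \<longlonglongrightarrow> 0"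
    using suminf_exist_split2[OF summable_ratio[of 1]] by simp
  moreover have "(\<Sum>i. 1 / \<mu> (i + n + 1)) = rest (Suc n)" for n
    by (simp add: rest_def)
  ultimately show ?thesis by (simp only: filterlim_sequentially_Suc)
qed

text \<open>
  Bang's bound needs a finite partial sum, which can be chosen to exceed anything strictly below the tail.
\<close>

lemma less_rest_imp_partial_sum:
  assumes "B < rest (Suc N)"
  obtains L where "N \<le> L" "B \<le> (\<Sum>j\<in>{N<..L}. 1 / \<mu> j)"
proof -
  have "(\<lambda>n. \<Sum>i<n. 1 / \<mu> (i + Suc N)) \<longlonglongrightarrow> rest (Suc N)"
    unfolding rest_def by (intro summable_LIMSEQ summable_ratio) simp
  from order_tendstoD(1)[OF this assms] obtain n where "B < (\<Sum>i<n. 1 / \<mu> (i + Suc N))"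
    by (auto simp: eventually_sequentially)
  then show ?thesis
    using that[of "N + n"] sum_ratio_shift[of N n] by (simp del: add_Suc_right)
qed

end

end

section \<open>Cancellation near the singularity\<close>

abbreviation osc :: "(real \<Rightarrow> real) \<Rightarrow> real \<Rightarrow> real \<Rightarrow> complex" where
  "osc \<psi> lam t \<equiv> exp (\<i> * complex_of_real (lam * \<psi> t))"

lemma norm_exp_i_diff_le: "norm (exp (\<i> * complex_of_real x) - exp (\<i> * complex_of_real y)) \<le> \<bar>x - y\<bar>"
proof -
  have "exp (\<i> * complex_of_real x) - exp (\<i> * complex_of_real y)
      = exp (\<i> * complex_of_real y) * (exp (\<i> * complex_of_real (x - y)) - 1)"
    by (simp add: right_diff_distrib mult_exp_exp)
  then have "norm (exp (\<i> * complex_of_real x) - exp (\<i> * complex_of_real y)) = 2 * \<bar>sin ((x - y) / 2)\<bar>"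
    using dist_exp_i_1[of "x - y"] by (simp add: norm_mult)
  also have "\<dots> \<le> \<bar>x - y\<bar>"
    using abs_sin_x_le_abs_x[of "(x - y) / 2"] by simp
  finally show ?thesis .
qed

context
  fixes \<psi> :: "real \<Rightarrow> real" and lam :: real
  assumes cont: "continuous_on {-1..1} \<psi>"
begin

lemma continuous_on_osc: "S \<subseteq> {-1..1} \<Longrightarrow> continuous_on S (osc \<psi> lam)"
  by (intro continuous_intros continuous_on_subset[OF cont])

lemma continuous_on_osc_reflect: "S \<subseteq> {-1..1} \<Longrightarrow> continuous_on S (\<lambda>t. osc \<psi> lam (- t))"
  by (rule continuous_on_compose2[OF continuous_on_osc[OF subset_refl]])
    (auto intro!: continuous_intros)

lemma osc_quotient_integrable:
  assumes "0 < a" "b \<le> 1"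
  shows "(\<lambda>t. osc \<psi> lam t / complex_of_real t) integrable_on {a..b}"
    and "(\<lambda>t. osc \<psi> lam (- t) / complex_of_real t) integrable_on {a..b}"
  using assms
  by (intro integrable_continuous_real continuous_on_divide continuous_on_osc
      continuous_on_osc_reflect continuous_on_of_real continuous_on_id; auto)+

text \<open>
  Folding \<open>t \<mapsto> -t\<close> exposes the cancellation of the odd kernel.
\<close>

lemma truncated_osc_integral_eq:
  assumes "0 < \<epsilon>" "\<epsilon> \<le> 1"
  shows "truncated_osc_integral \<psi> lam \<epsilon> =
    integral {\<epsilon>..1} (\<lambda>t. (osc \<psi> lam t - osc \<psi> lam (- t)) / complex_of_real t)"
proof -
  define F where "F t = osc \<psi> lam t / complex_of_real t" for t
  have F1: "F integrable_on {\<epsilon>..1}" and F3: "(\<lambda>t. F (- t)) integrable_on {\<epsilon>..1}"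
    using osc_quotient_integrable[of \<epsilon> 1] assms by (auto simp: F_def[abs_def] integrable_neg_iff)
  have F2: "F integrable_on {-1..-\<epsilon>}"
    using F3 Henstock_Kurzweil_Integration.integrable_reflect_real[where f = F and a = "-1" and b = "-\<epsilon>"]
    by simp
  have "{t. \<epsilon> \<le> \<bar>t\<bar> \<and> \<bar>t\<bar> \<le> 1} = {-1..-\<epsilon>} \<union> {\<epsilon>..1}" using assms by auto
  moreover have "{-1..-\<epsilon>} \<inter> {\<epsilon>..1} = {}" using assms by auto
  ultimately have "truncated_osc_integral \<psi> lam \<epsilon> = integral {-1..-\<epsilon>} F + integral {\<epsilon>..1} F"
    unfolding truncated_osc_integral_def using F1 F2
    by (simp add: Henstock_Kurzweil_Integration.integral_Un F_def[abs_def])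
  also have "integral {-1..-\<epsilon>} F = integral {\<epsilon>..1} (\<lambda>t. F (- t))"
    using Henstock_Kurzweil_Integration.integral_reflect_real[where f = "\<lambda>t. F (- t)" and a = \<epsilon> and b = 1]
    by simp
  also have "\<dots> + integral {\<epsilon>..1} F = integral {\<epsilon>..1} (\<lambda>t. F (- t) + F t)"
    using F1 F3 by (simp add: Henstock_Kurzweil_Integration.integral_add)
  also have "\<dots> = integral {\<epsilon>..1} (\<lambda>t. (osc \<psi> lam t - osc \<psi> lam (- t)) / complex_of_real t)"
    by (simp add: F_def diff_divide_distrib)
  finally show ?thesis .
qed

lemma osc_diff_quotient_integrable:
  assumes "0 < a" "b \<le> 1"
  shows "(\<lambda>t. (osc \<psi> lam t - osc \<psi> lam (- t)) / complex_of_real t) integrable_on {a..b}"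
  using integrable_diff[OF osc_quotient_integrable[OF assms]] by (simp add: diff_divide_distrib)

lemma norm_integral_osc_quotient_le:
  assumes "0 < a" "a \<le> b" "b \<le> 1"
  shows "norm (integral {a..b} (\<lambda>t. (osc \<psi> lam t - osc \<psi> lam (- t)) / complex_of_real t)) \<le> 2 * ln (b / a)"
proof -
  have "((\<lambda>t. 2 / t) has_integral 2 * ln b - 2 * ln a) {a..b}"
    using assms by (intro fundamental_theorem_of_calculus)
      (auto intro!: derivative_eq_intros simp flip: has_real_derivative_iff_has_vector_derivative)
  moreover have "norm ((osc \<psi> lam t - osc \<psi> lam (- t)) / complex_of_real t) \<le> 2 / t" if "t \<in> {a..b}" for t
    using that assms norm_triangle_ineq4[of "osc \<psi> lam t" "osc \<psi> lam (- t)"]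
    by (simp add: norm_divide divide_right_mono)
  ultimately show ?thesis
    using integral_norm_bound_integral[OF osc_diff_quotient_integrable, of a b "\<lambda>t. 2 / t"] assms
    by (auto simp: has_integral_iff ln_div algebra_simps)
qed

lemma norm_truncated_osc_integral_le:
  assumes "0 < a" "a \<le> 1"
  shows "norm (truncated_osc_integral \<psi> lam a) \<le> 2 * ln (1 / a)"
  using norm_integral_osc_quotient_le[of a 1] assms by (simp add: truncated_osc_integral_eq)

text \<open>
  On \<open>{\<epsilon>..a}\<close> the folded integrand is at most \<open>2 C (t / a) powr \<alpha> / t\<close>, whose integral is at most
  \<open>2 C / \<alpha>\<close> uniformly in \<open>\<epsilon>\<close>. The bound therefore survives the limit \<open>\<epsilon> \<rightarrow> 0\<close>.
\<close>

lemma norm_pv_osc_integral_le: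
  assumes diff: "\<psi> differentiable (at 0)" and lam: "0 < lam"
    and a: "0 < a" "a \<le> 1" and \<alpha>: "0 < \<alpha>" and C: "0 \<le> C"
    and small: "\<And>t. \<bar>t\<bar> \<le> a \<Longrightarrow> lam * \<bar>\<psi> t - \<psi> 0\<bar> \<le> C * (\<bar>t\<bar> / a) powr \<alpha>"
  shows "norm (pv_osc_integral \<psi> lam) \<le> 2 * C / \<alpha> + norm (truncated_osc_integral \<psi> lam a)"
proof -
  let ?q = "\<lambda>t. (osc \<psi> lam t - osc \<psi> lam (- t)) / complex_of_real t"
  have bound: "norm (truncated_osc_integral \<psi> lam \<epsilon>) \<le> 2 * C / \<alpha> + norm (truncated_osc_integral \<psi> lam a)"
    if \<epsilon>: "0 < \<epsilon>" "\<epsilon> < a" for \<epsilon>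
  proof -
    have I: "((\<lambda>t. 2 * C * (t / a) powr \<alpha> / t) has_integral
        2 * C / \<alpha> * (a / a) powr \<alpha> - 2 * C / \<alpha> * (\<epsilon> / a) powr \<alpha>) {\<epsilon>..a}"
      using \<epsilon> a \<alpha> by (intro fundamental_theorem_of_calculus)
        (auto intro!: derivative_eq_intros simp: powr_diff field_simps
          simp flip: has_real_derivative_iff_has_vector_derivative)
    have "norm (?q t) \<le> 2 * C * (t / a) powr \<alpha> / t" if t: "t \<in> {\<epsilon>..a}" for t
    proof -
      have "norm (osc \<psi> lam t - osc \<psi> lam (- t)) \<le> \<bar>lam * \<psi> t - lam * \<psi> (- t)\<bar>"
        by (rule norm_exp_i_diff_le)
      also have "\<dots> = \<bar>lam * (\<psi> t - \<psi> 0) - lam * (\<psi> (- t) - \<psi> 0)\<bar>"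
        by (simp add: algebra_simps)
      also have "\<dots> \<le> lam * \<bar>\<psi> t - \<psi> 0\<bar> + lam * \<bar>\<psi> (- t) - \<psi> 0\<bar>"
        using abs_triangle_ineq4[of "lam * (\<psi> t - \<psi> 0)" "lam * (\<psi> (- t) - \<psi> 0)"] lam
        by (simp add: abs_mult)
      also have "\<dots> \<le> 2 * C * (t / a) powr \<alpha>"
        using small[of t] small[of "- t"] t \<epsilon> by simp
      finally show ?thesis
        using t \<epsilon> by (simp add: norm_divide divide_right_mono)
    qed
    then have "norm (integral {\<epsilon>..a} ?q)
        \<le> 2 * C / \<alpha> * (a / a) powr \<alpha> - 2 * C / \<alpha> * (\<epsilon> / a) powr \<alpha>"
      using integral_norm_bound_integral[OF osc_diff_quotient_integrable, of \<epsilon> a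
          "\<lambda>t. 2 * C * (t / a) powr \<alpha> / t"] I \<epsilon> a
      by (auto simp: has_integral_iff)
    also have "\<dots> \<le> 2 * C / \<alpha>" using a \<alpha> C by simp
    finally have near: "norm (integral {\<epsilon>..a} ?q) \<le> 2 * C / \<alpha>" .
    have "truncated_osc_integral \<psi> lam \<epsilon> = integral {\<epsilon>..a} ?q + truncated_osc_integral \<psi> lam a"
      using Henstock_Kurzweil_Integration.integral_combine[of \<epsilon> a 1 ?q]
        osc_diff_quotient_integrable[of \<epsilon> 1] \<epsilon> a
      by (simp add: truncated_osc_integral_eq)
    then show ?thesis
      using near norm_triangle_ineq[of "integral {\<epsilon>..a} ?q" "truncated_osc_integral \<psi> lam a"] by simp
  qed
  have "((\<lambda>\<epsilon>. norm (truncated_osc_integral \<psi> lam \<epsilon>)) \<longlongrightarrow> norm (pv_osc_integral \<psi> lam)) (at_right 0)"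
    by (intro tendsto_norm truncated_osc_integral_tendsto cont diff)
  moreover have "eventually (\<lambda>\<epsilon>. norm (truncated_osc_integral \<psi> lam \<epsilon>)
      \<le> 2 * C / \<alpha> + norm (truncated_osc_integral \<psi> lam a)) (at_right 0)"
    using eventually_at_right_real[OF a(1)] by eventually_elim (auto intro: bound)
  ultimately show ?thesis
    by (rule tendsto_upperbound) simp
qed

end

section \<open>Phases of finite order at the singularity\<close>

text \<open>
  Integration by parts with \<open>w = 1 / (t \<phi>')\<close>: the derivative of \<open>exp (i lam \<phi>) w / (i lam)\<close> is the integrand
  plus \<open>H = exp (i lam \<phi>) w' / (i lam)\<close>. The hypotheses, which say that \<open>t \<phi>'\<close> has the size of \<open>t ^ k\<close>
  and \<open>t\<^sup>2 \<phi>''\<close> is not larger, give \<open>w = O(t ^ (-k))\<close> and \<open>w' = O(t ^ (-k-1))\<close>. Both the boundary terms and the integral of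
  \<open>H\<close> are thus of order \<open>1 / (lam a ^ k)\<close>.
\<close>

lemma norm_integral_nonstationary_le:
  fixes \<phi> p r :: "real \<Rightarrow> real"
  assumes "0 < a" "a \<le> b" "0 < lam" "0 < k" "0 < c" "0 \<le> C"
    and d1: "\<And>t. a \<le> t \<Longrightarrow> t \<le> b \<Longrightarrow> (\<phi> has_real_derivative p t) (at t)"
    and d2: "\<And>t. a \<le> t \<Longrightarrow> t \<le> b \<Longrightarrow> (p has_real_derivative r t) (at t)"
    and lower: "\<And>t. a \<le> t \<Longrightarrow> t \<le> b \<Longrightarrow> c * t ^ k \<le> \<bar>t * p t\<bar>"
    and upper: "\<And>t. a \<le> t \<Longrightarrow> t \<le> b \<Longrightarrow> \<bar>t * p t\<bar> \<le> C * t ^ k"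
    and upper2: "\<And>t. a \<le> t \<Longrightarrow> t \<le> b \<Longrightarrow> \<bar>t\<^sup>2 * r t\<bar> \<le> C * t ^ k"
  shows "norm (integral {a..b} (\<lambda>t. osc \<phi> lam t / complex_of_real t))
    \<le> (2 / c + 2 * C / c\<^sup>2) / (lam * a ^ k)"
proof -
  define w where "w t = 1 / (t * p t)" for t
  define w' where "w' t = - (p t + t * r t) / (t * p t)\<^sup>2" for t
  define G where "G t = osc \<phi> lam t * complex_of_real (w t) / (\<i> * complex_of_real lam)" for t
  define H where "H t = osc \<phi> lam t * complex_of_real (w' t) / (\<i> * complex_of_real lam)" for t
  have t0: "t > 0" "c * t ^ k > 0" if "a \<le> t" for t
    using assms(1,5) that by auto
  have nz: "t * p t \<noteq> 0" if "a \<le> t" "t \<le> b" for t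
    using lower[OF that] t0[OF that(1)] by auto
  have dw: "(w has_real_derivative w' t) (at t)" if "a \<le> t" "t \<le> b" for t
    unfolding w_def w'_def using nz[OF that]
    by (auto intro!: derivative_eq_intros d2 that simp: power2_eq_square divide_simps)
  have dG: "(G has_vector_derivative (osc \<phi> lam t / complex_of_real t + H t)) (at t within {a..b})"
    if "t \<in> {a..b}" for t
  proof -
    have t: "a \<le> t" "t \<le> b" using that by auto
    have e: "((\<lambda>t. osc \<phi> lam t) has_vector_derivative (\<i> * complex_of_real (lam * p t)) * osc \<phi> lam t) (at t)"
    proof -
      have "((\<lambda>t. \<i> * complex_of_real (lam * \<phi> t)) has_vector_derivative
          \<i> * complex_of_real (lam * p t)) (at t)"
        by (intro has_vector_derivative_mult_right has_vector_derivative_of_real DERIV_cmult d1 t)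
      from field_vector_diff_chain_at[OF this DERIV_exp] show ?thesis by (simp add: o_def)
    qed
    have wv: "((\<lambda>t. complex_of_real (w t)) has_vector_derivative complex_of_real (w' t)) (at t)"
      using dw[OF t] by (rule has_vector_derivative_of_real)
    have "(G has_vector_derivative (osc \<phi> lam t * complex_of_real (w' t)
        + (\<i> * complex_of_real (lam * p t)) * osc \<phi> lam t * complex_of_real (w t)) / (\<i> * complex_of_real lam)) (at t)"
      unfolding G_def by (intro has_vector_derivative_divide has_vector_derivative_mult e wv)
    moreover have "(osc \<phi> lam t * complex_of_real (w' t)
        + (\<i> * complex_of_real (lam * p t)) * osc \<phi> lam t * complex_of_real (w t)) / (\<i> * complex_of_real lam)
      = osc \<phi> lam t / complex_of_real t + H t"
    proof -
      have "p t \<noteq> 0" "t \<noteq> 0" using nz[OF t] by auto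
      then have "\<i> * complex_of_real (lam * p t) * complex_of_real (w t) / (\<i> * complex_of_real lam)
          = 1 / complex_of_real t"
        using \<open>0 < lam\<close> by (simp add: w_def field_simps)
      then have "(\<i> * complex_of_real (lam * p t) * osc \<phi> lam t * complex_of_real (w t)) / (\<i> * complex_of_real lam)
          = osc \<phi> lam t / complex_of_real t"
        by (metis (no_types, opaque_lifting) mult.commute mult.assoc times_divide_eq_right mult.right_neutral)
      then show ?thesis by (simp add: H_def add_divide_distrib)
    qed
    ultimately show ?thesis by (metis has_vector_derivative_at_within)
  qed
  have fund: "((\<lambda>t. osc \<phi> lam t / complex_of_real t + H t) has_integral G b - G a) {a..b}"
    using assms(2) dG by (rule fundamental_theorem_of_calculus)
  have "continuous_on {a..b} \<phi>"
    by (meson DERIV_isCont atLeastAtMost_iff continuous_at_imp_continuous_on d1)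
  then have int: "(\<lambda>t. osc \<phi> lam t / complex_of_real t) integrable_on {a..b}"
    using assms(1) by (intro integrable_continuous_real continuous_intros) auto
  have intH: "H integrable_on {a..b}"
    using integrable_diff[OF has_integral_integrable[OF fund] int] by simp
  have eq: "integral {a..b} (\<lambda>t. osc \<phi> lam t / complex_of_real t) = G b - G a - integral {a..b} H"
    using integral_unique[OF fund] integral_add[OF int intH] by simp
  have Gle: "norm (G t) \<le> 1 / c / (lam * a ^ k)" if "a \<le> t" "t \<le> b" for t
  proof -
    have "c * a ^ k \<le> \<bar>t * p t\<bar>"
      using lower[OF that] power_mono[of a t k] assms(1,5) that
      by (meson less_imp_le mult_left_mono order_trans)
    then have "1 / \<bar>t * p t\<bar> \<le> 1 / (c * a ^ k)"
      using assms(1,5) by (intro frac_le) auto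
    from divide_right_mono[OF this, of lam] show ?thesis
      using \<open>0 < lam\<close> by (simp add: G_def w_def norm_mult norm_divide abs_mult mult_ac)
  qed
  have Hle: "norm (H t) \<le> 2 * C / c\<^sup>2 / lam * (1 / t ^ (k + 1))" if t: "t \<in> {a..b}" for t
  proof -
    have t': "a \<le> t" "t \<le> b" "t > 0" using t assms(1) by auto
    have "\<bar>t * (p t + t * r t)\<bar> \<le> \<bar>t * p t\<bar> + \<bar>t\<^sup>2 * r t\<bar>"
      using abs_triangle_ineq[of "t * p t" "t\<^sup>2 * r t"] by (simp add: algebra_simps power2_eq_square)
    then have "t * \<bar>p t + t * r t\<bar> \<le> 2 * C * t ^ k"
      using upper[OF t'(1,2)] upper2[OF t'(1,2)] t'(3) by (simp add: abs_mult)
    then have num: "\<bar>p t + t * r t\<bar> \<le> 2 * C * t ^ k / t"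
      using t'(3) by (simp add: field_simps)
    have den: "(c * t ^ k)\<^sup>2 \<le> (t * p t)\<^sup>2"
      using lower[OF t'(1,2)] t0(2)[OF t'(1)] by (metis abs_le_square_iff abs_of_pos)
    have "\<bar>w' t\<bar> \<le> (2 * C * t ^ k / t) / (c * t ^ k)\<^sup>2"
      unfolding w'_def abs_divide using num den t0[OF t'(1)] assms(6) by (intro frac_le) auto
    also have "\<dots> = 2 * C / c\<^sup>2 * (1 / t ^ (k + 1))"
      using t'(3) assms(5) by (simp add: field_simps power2_eq_square)
    finally have "\<bar>w' t\<bar> / lam \<le> 2 * C / c\<^sup>2 * (1 / t ^ (k + 1)) / lam"
      using \<open>0 < lam\<close> by (intro divide_right_mono) auto
    then show ?thesis
      using \<open>0 < lam\<close> by (simp add: H_def norm_mult norm_divide mult_ac)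
  qed
  have pw: "((\<lambda>t. 2 * C / c\<^sup>2 / lam * (1 / t ^ (k + 1))) has_integral
      2 * C / c\<^sup>2 / lam * (- (1 / (k * b ^ k)) - - (1 / (k * a ^ k)))) {a..b}"
  proof (intro has_integral_mult_right fundamental_theorem_of_calculus)
    fix t assume "t \<in> {a..b}"
    then have "t > 0" using assms(1) by auto
    obtain k' where k': "k = Suc k'" using assms(4) gr0_conv_Suc by blast
    have "((\<lambda>t. t ^ k) has_real_derivative real k * t ^ (k - 1)) (at t within {a..b})"
      by (auto intro!: derivative_eq_intros)
    from DERIV_cmult[OF DERIV_inverse'[OF this], of "- 1 / real k"] \<open>t > 0\<close>
    have "((\<lambda>t. - 1 / real k * inverse (t ^ k)) has_real_derivative
        - 1 / real k * - (inverse (t ^ k) * (real k * t ^ (k - 1)) * inverse (t ^ k))) (at t within {a..b})"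
      by simp
    moreover have "- 1 / real k * - (inverse (t ^ k) * (real k * t ^ (k - 1)) * inverse (t ^ k)) = 1 / t ^ (k + 1)"
      using \<open>t > 0\<close> unfolding k' by (simp add: divide_simps)
    moreover have "- (1 / (real k * s ^ k)) = - 1 / real k * inverse (s ^ k)" for s :: real
      by (simp add: divide_inverse)
    ultimately show "((\<lambda>t. - (1 / (real k * t ^ k))) has_vector_derivative 1 / t ^ (k + 1)) (at t within {a..b})"
      by (simp only: has_real_derivative_iff_has_vector_derivative)
  qed (use assms in auto)
  have "norm (integral {a..b} H) \<le> 2 * C / c\<^sup>2 / lam * (- (1 / (k * b ^ k)) - - (1 / (k * a ^ k)))"
    using integral_norm_bound_integral[OF intH has_integral_integrable[OF pw] Hle]
      integral_unique[OF pw] by simp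
  also have "\<dots> \<le> 2 * C / c\<^sup>2 / lam * (1 / a ^ k)"
  proof (intro mult_left_mono)
    have "1 / (k * a ^ k) \<le> 1 / a ^ k"
      using assms(1,4) by (simp add: field_simps)
    moreover have "0 \<le> 1 / (k * b ^ k)" using assms(1,2) by simp
    ultimately show "- (1 / (k * b ^ k)) - - (1 / (k * a ^ k)) \<le> 1 / a ^ k" by linarith
  qed (use assms in auto)
  finally have "norm (integral {a..b} H) \<le> 2 * C / c\<^sup>2 / (lam * a ^ k)" by simp
  moreover have "norm (G b - G a - integral {a..b} H) \<le> norm (G b) + norm (G a) + norm (integral {a..b} H)"
    by (meson add_mono_thms_linordered_semiring(3) norm_triangle_ineq4 order_trans)
  moreover have "(2 / c + 2 * C / c\<^sup>2) / (lam * a ^ k)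
      = 1 / c / (lam * a ^ k) + 1 / c / (lam * a ^ k) + 2 * C / c\<^sup>2 / (lam * a ^ k)"
    by (simp add: add_divide_distrib)
  ultimately show ?thesis
    using Gle[of a] Gle[of b] assms(2) unfolding eq by linarith
qed

text \<open>
  Lagrange's form of the remainder; stating it with weak inequalities for \<open>\<xi>\<close> includes \<open>m = 0\<close> and \<open>t = 0\<close>.
\<close>

lemma leading_taylor_term:
  fixes F :: "nat \<Rightarrow> real \<Rightarrow> real"
  assumes deriv: "\<And>n t. 0 \<le> t \<Longrightarrow> t < R \<Longrightarrow> (F n has_real_derivative F (Suc n) t) (at t)"
    and zero: "\<And>j. j < m \<Longrightarrow> F j 0 = 0" and t: "0 \<le> t" "t < R"
  obtains \<xi> where "0 \<le> \<xi>" "\<xi> \<le> t" "F 0 t = F m \<xi> / fact m * t ^ m"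
proof (cases "m = 0 \<or> t = 0")
  case True
  then have "F 0 t = F m t / fact m * t ^ m"
    using zero[of 0] by (cases "m = 0") auto
  then show ?thesis using that[of t] t by simp
next
  case False
  then obtain \<xi> where "0 < \<xi>" "\<xi> < t"
    "F 0 t = (\<Sum>j<m. F j 0 / fact j * t ^ j) + F m \<xi> / fact m * t ^ m"
    using Maclaurin[of t m F "F 0"] deriv t by force
  then show ?thesis using that[of \<xi>] zero by simp
qed

text \<open>
  The function and its first two derivatives are expanded so that the remainder always involves \<open>D k\<close>, which is
  bounded and, near \<open>0\<close>, bounded away from \<open>0\<close>. For \<open>k = 1\<close> no expansion of \<open>D 2\<close> is available, but
  then \<open>t\<^sup>2 \<le> t\<close> compensates for it; this is why \<open>B 2\<close> enters the constant.
\<close>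

lemma finite_order_estimates:
  fixes D :: "nat \<Rightarrow> real \<Rightarrow> real"
  assumes deriv: "\<And>n t. 0 \<le> t \<Longrightarrow> t < 1 \<Longrightarrow> (D n has_real_derivative D (Suc n) t) (at t)"
    and bound: "\<And>n t. 0 \<le> t \<Longrightarrow> t < 1 \<Longrightarrow> \<bar>D n t\<bar> \<le> B n"
    and k: "0 < k" "D k 0 \<noteq> 0" and zero: "\<And>j. 0 < j \<Longrightarrow> j < k \<Longrightarrow> D j 0 = 0"
  obtains \<delta> c where "0 < \<delta>" "\<delta> < 1" "0 < c"
    and "\<And>t. 0 \<le> t \<Longrightarrow> t \<le> \<delta> \<Longrightarrow> \<bar>D 0 t - D 0 0\<bar> \<le> (B k + B 2) * t ^ k"
    and "\<And>t. 0 \<le> t \<Longrightarrow> t \<le> \<delta> \<Longrightarrow> c * t ^ k \<le> \<bar>t * D 1 t\<bar>"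
    and "\<And>t. 0 \<le> t \<Longrightarrow> t \<le> \<delta> \<Longrightarrow> \<bar>t * D 1 t\<bar> \<le> (B k + B 2) * t ^ k"
    and "\<And>t. 0 \<le> t \<Longrightarrow> t \<le> \<delta> \<Longrightarrow> \<bar>t\<^sup>2 * D 2 t\<bar> \<le> (B k + B 2) * t ^ k"
proof -
  have B0: "0 \<le> B n" for n using bound[of 0 n] by linarith
  have "isCont (D k) 0" using deriv[of 0 k] DERIV_isCont by auto
  moreover have "0 < \<bar>D k 0\<bar> / 2" using k by simp
  ultimately obtain \<delta>\<^sub>0 where \<delta>\<^sub>0: "0 < \<delta>\<^sub>0" "\<And>t. \<bar>t\<bar> < \<delta>\<^sub>0 \<Longrightarrow> \<bar>D k t - D k 0\<bar> < \<bar>D k 0\<bar> / 2"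
    unfolding continuous_at_eps_delta dist_real_def diff_0_right by blast
  define \<delta> where "\<delta> = min (1 / 2) (\<delta>\<^sub>0 / 2)"
  define c where "c = \<bar>D k 0\<bar> / 2 / fact (k - 1)"
  have \<delta>: "0 < \<delta>" "\<delta> < 1" "\<delta> < \<delta>\<^sub>0" using \<delta>\<^sub>0 by (auto simp: \<delta>_def)
  have scaled: "\<bar>v / fact m * t ^ k\<bar> \<le> (B k + B 2) * t ^ k"
    if "\<bar>v\<bar> \<le> B k" "0 \<le> t" for v t and m
  proof -
    have "\<bar>v\<bar> / fact m \<le> B k / 1"
      using that B0[of k] by (intro frac_le) (auto simp: fact_ge_1)
    then have "\<bar>v\<bar> / fact m * t ^ k \<le> (B k + B 2) * t ^ k"
      using B0[of 2] that by (intro mult_right_mono) auto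
    then show ?thesis using that by (simp add: abs_mult)
  qed
  have first: "\<exists>\<xi>. 0 \<le> \<xi> \<and> \<xi> \<le> t \<and> t * D 1 t = D k \<xi> / fact (k - 1) * t ^ k"
    if t: "0 \<le> t" "t \<le> \<delta>" for t
  proof -
    obtain \<xi> where "0 \<le> \<xi>" "\<xi> \<le> t" "D (0 + 1) t = D (k - 1 + 1) \<xi> / fact (k - 1) * t ^ (k - 1)"
      by (rule leading_taylor_term[of 1 "\<lambda>n. D (n + 1)" "k - 1" t]) (use t \<delta> k deriv zero in auto)
    then show ?thesis using k by (intro exI[of _ \<xi>]) (auto simp: power_eq_if)
  qed
  show ?thesis
  proof (rule that[of \<delta> c])
    show "0 < \<delta>" "\<delta> < 1" "0 < c" using \<delta> k by (auto simp: c_def)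
  next
    fix t assume t: "0 \<le> t" "t \<le> \<delta>"
    define F where "F n = (if n = 0 then (\<lambda>t. D 0 t - D 0 0) else D n)" for n
    have "(F n has_real_derivative F (Suc n) s) (at s)" if "0 \<le> s" "s < 1" for n s
      using deriv[OF that, of n] by (auto simp: F_def intro!: derivative_eq_intros)
    then obtain \<xi> where "0 \<le> \<xi>" "\<xi> \<le> t" "F 0 t = F k \<xi> / fact k * t ^ k"
      by (rule leading_taylor_term[of 1 F k t]) (use t \<delta> zero in \<open>auto simp: F_def\<close>)
    then show "\<bar>D 0 t - D 0 0\<bar> \<le> (B k + B 2) * t ^ k"
      using scaled[of "D k \<xi>" t k] bound[of \<xi> k] t \<delta> k by (simp add: F_def)
  next
    fix t assume t: "0 \<le> t" "t \<le> \<delta>"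
    obtain \<xi> where \<xi>: "0 \<le> \<xi>" "\<xi> \<le> t" "t * D 1 t = D k \<xi> / fact (k - 1) * t ^ k"
      using first[OF t] by blast
    show "\<bar>t * D 1 t\<bar> \<le> (B k + B 2) * t ^ k"
      using scaled[of "D k \<xi>" t "k - 1"] bound[of \<xi> k] t \<delta> \<xi> by simp
    have "\<bar>D k 0\<bar> / 2 \<le> \<bar>D k \<xi>\<bar>" using \<delta>\<^sub>0(2)[of \<xi>] \<xi> t \<delta> by linarith
    then have "c * t ^ k \<le> \<bar>D k \<xi>\<bar> / fact (k - 1) * t ^ k"
      unfolding c_def using t by (intro mult_right_mono divide_right_mono) auto
    then show "c * t ^ k \<le> \<bar>t * D 1 t\<bar>" using \<xi> t by (simp add: abs_mult)
  next
    fix t assume t: "0 \<le> t" "t \<le> \<delta>"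
    show "\<bar>t\<^sup>2 * D 2 t\<bar> \<le> (B k + B 2) * t ^ k"
    proof (cases "k = 1")
      case True
      have "t * (t * \<bar>D 2 t\<bar>) \<le> t * (1 * B 2)"
        using bound[of t 2] t \<delta> by (intro mult_left_mono mult_mono) auto
      then have "t\<^sup>2 * \<bar>D 2 t\<bar> \<le> B 2 * t" by (simp add: power2_eq_square mult_ac)
      moreover have "0 \<le> B k * t" using B0 t by simp
      ultimately show ?thesis using True by (simp add: abs_mult distrib_right)
    next
      case False
      obtain \<xi> where \<xi>: "0 \<le> \<xi>" "\<xi> \<le> t" "D (0 + 2) t = D (k - 2 + 2) \<xi> / fact (k - 2) * t ^ (k - 2)"
        by (rule leading_taylor_term[of 1 "\<lambda>n. D (n + 2)" "k - 2" t]) (use t \<delta> k deriv zero False in auto)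
      have k2: "2 + (k - 2) = k" using False k by arith
      then have tk: "t\<^sup>2 * t ^ (k - 2) = t ^ k" by (metis power_add)
      have "D 2 t = D k \<xi> / fact (k - 2) * t ^ (k - 2)"
        using \<xi>(3) by (simp only: add_0 add.commute[of "k - 2" 2] k2)
      then have "t\<^sup>2 * D 2 t = D k \<xi> / fact (k - 2) * t ^ k"
        by (simp flip: tk)
      then show ?thesis
        using scaled[of "D k \<xi>" t "k - 2"] bound[of \<xi> k] t \<delta> \<xi> by simp
    qed
  qed
qed

lemma reflected_derivatives:
  fixes D :: "nat \<Rightarrow> real \<Rightarrow> real"
  assumes "\<And>n t. \<bar>t\<bar> < R \<Longrightarrow> (D n has_real_derivative D (Suc n) t) (at t)" "\<bar>t\<bar> < R"
  shows "((\<lambda>s. (-1) ^ n * D n (- s)) has_real_derivative (-1) ^ Suc n * D (Suc n) (- t)) (at t)"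
proof -
  have "(D n has_real_derivative D (Suc n) (- t)) (at (- t))" using assms by simp
  then have "((\<lambda>s. D n (- s)) has_real_derivative D (Suc n) (- t) * - 1) (at t)"
    by (rule DERIV_chain2) (auto intro!: derivative_eq_intros)
  then show ?thesis using DERIV_cmult[of _ _ t UNIV "(-1) ^ n"] by fastforce
qed

text \<open>
  The scale \<open>a = lam powr (-1/k)\<close> balances both regimes: below it the phase varies by \<open>O(1)\<close>, and above it
  integration by parts gives \<open>O(1 / (lam a ^ k)) = O(1)\<close>. There the two half-lines are treated
  separately, since oscillation on each of them already suffices. For small \<open>lam\<close> the scale is cut off at \<open>\<delta>\<close>.
\<close>

lemma finite_order_imp_bounded:
  fixes D :: "nat \<Rightarrow> real \<Rightarrow> real" and \<psi> :: "real \<Rightarrow> real"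
  assumes cont: "continuous_on {-1..1} \<psi>" and D0: "D 0 = \<psi>"
    and deriv: "\<And>n t. \<bar>t\<bar> < 1 \<Longrightarrow> (D n has_real_derivative D (Suc n) t) (at t)"
    and bound: "\<And>n t. \<bar>t\<bar> < 1 \<Longrightarrow> \<bar>D n t\<bar> \<le> B n"
    and nonflat: "0 < n\<^sub>0" "D n\<^sub>0 0 \<noteq> 0"
  obtains C where "\<And>lam. 1 \<le> lam \<Longrightarrow> norm (pv_osc_integral \<psi> lam) \<le> C"
proof -
  define k where "k = (LEAST n. 0 < n \<and> D n 0 \<noteq> 0)"
  have k: "0 < k" "D k 0 \<noteq> 0"
    using LeastI[of "\<lambda>n. 0 < n \<and> D n 0 \<noteq> 0" n\<^sub>0] nonflat by (auto simp: k_def)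
  have zero: "D j 0 = 0" if "0 < j" "j < k" for j
    using not_less_Least[of j "\<lambda>n. 0 < n \<and> D n 0 \<noteq> 0"] that by (auto simp: k_def)
  define D' where "D' n t = (-1) ^ n * D n (- t)" for n t
  define A where "A = B k + B 2"
  have A0: "0 \<le> A" using bound[of 0 k] bound[of 0 2] by (simp add: A_def)
  have deriv': "(D' n has_real_derivative D' (Suc n) t) (at t)" if "\<bar>t\<bar> < 1" for n t
    unfolding D'_def[abs_def] by (rule reflected_derivatives[of 1 D, OF deriv that])
  have bound': "\<bar>D' n t\<bar> \<le> B n" if "\<bar>t\<bar> < 1" for n t
    using bound[of "- t" n] that by (simp add: D'_def abs_mult)
  obtain \<delta>1 c1 where 1: "0 < \<delta>1" "\<delta>1 < 1" "0 < c1"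
    "\<And>t. 0 \<le> t \<Longrightarrow> t \<le> \<delta>1 \<Longrightarrow> \<bar>D 0 t - D 0 0\<bar> \<le> A * t ^ k"
    "\<And>t. 0 \<le> t \<Longrightarrow> t \<le> \<delta>1 \<Longrightarrow> c1 * t ^ k \<le> \<bar>t * D 1 t\<bar>"
    "\<And>t. 0 \<le> t \<Longrightarrow> t \<le> \<delta>1 \<Longrightarrow> \<bar>t * D 1 t\<bar> \<le> A * t ^ k"
    "\<And>t. 0 \<le> t \<Longrightarrow> t \<le> \<delta>1 \<Longrightarrow> \<bar>t\<^sup>2 * D 2 t\<bar> \<le> A * t ^ k"
    unfolding A_def
    by (rule finite_order_estimates[of D B k]) (use deriv bound k zero in auto)
  obtain \<delta>2 c2 where 2: "0 < \<delta>2" "\<delta>2 < 1" "0 < c2"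
    "\<And>t. 0 \<le> t \<Longrightarrow> t \<le> \<delta>2 \<Longrightarrow> \<bar>D' 0 t - D' 0 0\<bar> \<le> A * t ^ k"
    "\<And>t. 0 \<le> t \<Longrightarrow> t \<le> \<delta>2 \<Longrightarrow> c2 * t ^ k \<le> \<bar>t * D' 1 t\<bar>"
    "\<And>t. 0 \<le> t \<Longrightarrow> t \<le> \<delta>2 \<Longrightarrow> \<bar>t * D' 1 t\<bar> \<le> A * t ^ k"
    "\<And>t. 0 \<le> t \<Longrightarrow> t \<le> \<delta>2 \<Longrightarrow> \<bar>t\<^sup>2 * D' 2 t\<bar> \<le> A * t ^ k"
    unfolding A_def
    by (rule finite_order_estimates[of D' B k])
      (use deriv' bound' k zero in \<open>auto simp: D'_def[of _ 0]\<close>)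
  define \<delta> where "\<delta> = min \<delta>1 \<delta>2"
  have \<delta>: "0 < \<delta>" "\<delta> < 1" "\<delta> \<le> \<delta>1" "\<delta> \<le> \<delta>2" using 1 2 by (auto simp: \<delta>_def)
  define E where "E c = 2 / c + 2 * A / c\<^sup>2" for c
  have E0: "0 \<le> E c1" "0 \<le> E c2" using A0 1 2 by (auto simp: E_def)
  have "norm (pv_osc_integral \<psi> lam) \<le> 2 * A / k + (E c1 + E c2 + 2 * ln (1 / \<delta>))" if lam: "1 \<le> lam" for lam
  proof -
    define a where "a = min \<delta> (lam powr (- 1 / k))"
    have a: "0 < a" "a \<le> \<delta>" "a \<le> 1" using \<delta> lam by (auto simp: a_def)
    have "(lam powr (- 1 / k)) ^ k = (lam powr (- 1 / k)) powr k"
      using lam by (simp add: powr_realpow)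
    also have "\<dots> = lam powr (- 1)"
      using k by (simp only: powr_powr) simp
    also have "\<dots> = 1 / lam"
      using lam by (simp add: powr_minus_divide)
    finally have rk: "(lam powr (- 1 / k)) ^ k = 1 / lam" .
    have "a ^ k \<le> (lam powr (- 1 / k)) ^ k"
      using a by (intro power_mono) (auto simp: a_def)
    then have "lam * a ^ k \<le> lam * (1 / lam)"
      unfolding rk using lam by (intro mult_left_mono) auto
    then have lamak: "lam * a ^ k \<le> 1" using lam by simp
    let ?q = "\<lambda>t. (osc \<psi> lam t - osc \<psi> lam (- t)) / complex_of_real t"
    have "norm (pv_osc_integral \<psi> lam) \<le> 2 * A / k + norm (truncated_osc_integral \<psi> lam a)"
    proof (rule norm_pv_osc_integral_le[OF cont])
      show "\<psi> differentiable at 0"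
        using deriv[of 0 0] D0 real_differentiable_def by auto
      fix t :: real assume t: "\<bar>t\<bar> \<le> a"
      have "\<bar>\<psi> t - \<psi> 0\<bar> \<le> A * \<bar>t\<bar> ^ k"
      proof (cases "0 \<le> t")
        case True
        then show ?thesis using 1(4)[of t] t a \<delta> by (simp add: D0)
      next
        case False
        then show ?thesis using 2(4)[of "- t"] t a \<delta> by (simp add: D'_def D0)
      qed
      then have "lam * \<bar>\<psi> t - \<psi> 0\<bar> \<le> lam * (A * \<bar>t\<bar> ^ k)"
        using lam by (intro mult_left_mono) auto
      also have "\<dots> = A * (lam * a ^ k) * (\<bar>t\<bar> / a) ^ k"
        using a by (simp add: power_divide)
      also have "\<dots> \<le> A * 1 * (\<bar>t\<bar> / a) ^ k"
        using lamak A0 a by (intro mult_right_mono mult_left_mono) auto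
      also have "(\<bar>t\<bar> / a) ^ k = (\<bar>t\<bar> / a) powr k"
        using a k by (cases "t = 0") (auto simp: powr_realpow)
      finally show "lam * \<bar>\<psi> t - \<psi> 0\<bar> \<le> A * (\<bar>t\<bar> / a) powr k" by simp
    qed (use lam a k A0 in auto)
    moreover have "norm (truncated_osc_integral \<psi> lam a) \<le> E c1 + E c2 + 2 * ln (1 / \<delta>)"
    proof -
      have "truncated_osc_integral \<psi> lam a = integral {a..\<delta>} ?q + integral {\<delta>..1} ?q"
        using Henstock_Kurzweil_Integration.integral_combine[of a \<delta> 1 ?q]
          osc_diff_quotient_integrable[OF cont, of a 1 lam] a \<delta>
        by (simp add: truncated_osc_integral_eq[OF cont])
      moreover have "norm (integral {\<delta>..1} ?q) \<le> 2 * ln (1 / \<delta>)"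
        using \<delta> by (intro norm_integral_osc_quotient_le[OF cont]) auto
      moreover have "norm (integral {a..\<delta>} ?q) \<le> E c1 + E c2"
      proof (cases "a = \<delta>")
        case True
        then show ?thesis using E0 by simp
      next
        case False
        then have "a = lam powr (- 1 / k)" by (auto simp: a_def min_def split: if_splits)
        then have lamak1: "lam * a ^ k = 1" using rk lam by simp
        have one_sided: "norm (integral {a..\<delta>} (\<lambda>t. osc (F 0) lam t / complex_of_real t)) \<le> E c / (lam * a ^ k)"
          if "0 < c" and F: "\<And>n t. \<bar>t\<bar> < 1 \<Longrightarrow> (F n has_real_derivative F (Suc n) t) (at t)"
            and "\<And>t. 0 \<le> t \<Longrightarrow> t \<le> \<delta> \<Longrightarrow> c * t ^ k \<le> \<bar>t * F 1 t\<bar>"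
            and "\<And>t. 0 \<le> t \<Longrightarrow> t \<le> \<delta> \<Longrightarrow> \<bar>t * F 1 t\<bar> \<le> A * t ^ k"
            and "\<And>t. 0 \<le> t \<Longrightarrow> t \<le> \<delta> \<Longrightarrow> \<bar>t\<^sup>2 * F 2 t\<bar> \<le> A * t ^ k"
          for F :: "nat \<Rightarrow> real \<Rightarrow> real" and c
          unfolding E_def
        proof (rule norm_integral_nonstationary_le[of a \<delta> lam k c A "F 0" "F 1" "F 2"])
          show "(F 0 has_real_derivative F 1 t) (at t)" "(F 1 has_real_derivative F 2 t) (at t)"
            if "a \<le> t" "t \<le> \<delta>" for t
            using F[of t 0] F[of t 1] that a \<delta> by (simp_all add: numeral_2_eq_2)
        qed (use that a \<delta> lam k A0 in auto)
        have "norm (integral {a..\<delta>} (\<lambda>t. osc \<psi> lam t / complex_of_real t)) \<le> E c1 / (lam * a ^ k)"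
          unfolding D0[symmetric]
          by (intro one_sided deriv 1 order_trans[OF _ \<delta>(3)]) auto
        moreover have "norm (integral {a..\<delta>} (\<lambda>t. osc (D' 0) lam t / complex_of_real t)) \<le> E c2 / (lam * a ^ k)"
          by (intro one_sided deriv' 2 order_trans[OF _ \<delta>(4)]) auto
        moreover have "osc (D' 0) lam t = osc \<psi> lam (- t)" for t
          by (simp add: D'_def D0)
        moreover have "integral {a..\<delta>} ?q = integral {a..\<delta>} (\<lambda>t. osc \<psi> lam t / complex_of_real t)
            - integral {a..\<delta>} (\<lambda>t. osc \<psi> lam (- t) / complex_of_real t)"
          using osc_quotient_integrable[OF cont, of a \<delta> lam] a \<delta>
          by (simp add: diff_divide_distrib Henstock_Kurzweil_Integration.integral_diff)
        ultimately show ?thesis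
          using norm_triangle_ineq4[of "integral {a..\<delta>} (\<lambda>t. osc \<psi> lam t / complex_of_real t)"
              "integral {a..\<delta>} (\<lambda>t. osc \<psi> lam (- t) / complex_of_real t)"]
          by (simp add: lamak1)
      qed
      ultimately show ?thesis
        using norm_triangle_ineq[of "integral {a..\<delta>} ?q" "integral {\<delta>..1} ?q"] by simp
    qed
    ultimately show ?thesis by simp
  qed
  then show ?thesis by (rule that)
qed

section \<open>Flat phases\<close>

context log_convex_weights
begin

text \<open>
  Bang's bound for the weights \<open>2 K ^ (n + 1) M n\<close>, whose ratios are \<open>K \<mu> n\<close>. The factor \<open>2\<close> leaves room for
  subtracting the value at \<open>0\<close>, after which the function itself vanishes there together with its derivatives.
\<close>

lemma bang_flat_scaled:
  fixes D :: "nat \<Rightarrow> real \<Rightarrow> real"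
  assumes K: "0 < K"
    and deriv: "\<And>n t. 0 \<le> t \<Longrightarrow> t < 1 \<Longrightarrow> (D n has_real_derivative D (Suc n) t) (at t)"
    and bound: "\<And>n t. 0 \<le> t \<Longrightarrow> t < 1 \<Longrightarrow> \<bar>D n t\<bar> \<le> K ^ (n + 1) * M n"
    and flat: "\<And>n. 0 < n \<Longrightarrow> D n 0 = 0"
    and x: "N \<le> L" "0 \<le> x" "x < 1" "x \<le> (\<Sum>j\<in>{N<..L}. 1 / \<mu> j) / (exp 1 * K)"
  shows "\<bar>D 0 x - D 0 0\<bar> \<le> 2 * K * M 0 * exp (- real N)"
proof -
  define W where "W n = 2 * K ^ (n + 1) * M n" for n
  define F where "F n = (if n = 0 then (\<lambda>t. D 0 t - D 0 0) else D n)" for n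
  interpret W: log_convex_weights W
  proof
    show "0 < W n" for n using K pos by (simp add: W_def)
    show "log_convex_seq W"
      unfolding log_convex_seq_def
    proof (intro allI impI)
      fix n :: nat assume n: "1 \<le> n"
      have "(M n)\<^sup>2 \<le> M (n - 1) * M (n + 1)" using lc n by (simp add: log_convex_seq_def)
      then have "(2 * K ^ (n + 1))\<^sup>2 * (M n)\<^sup>2 \<le> (2 * K ^ (n + 1))\<^sup>2 * (M (n - 1) * M (n + 1))"
        by (intro mult_left_mono) auto
      moreover have "(2 * K ^ (n + 1))\<^sup>2 = (2 * K ^ (n - 1 + 1)) * (2 * K ^ (n + 1 + 1))"
        using n by (cases n) (auto simp: power2_eq_square)
      ultimately show "(W n)\<^sup>2 \<le> W (n - 1) * W (n + 1)"
        by (simp add: W_def power_mult_distrib mult_ac)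
    qed
  qed
  have ratio: "seq_ratio W j = K * \<mu> j" if "0 < j" for j
    using that K pos[of "j - 1"] by (cases j) (auto simp: seq_ratio_def W_def)
  have "\<bar>F 0 x\<bar> \<le> exp (- real N) * exp (real 0) * W 0"
  proof (rule W.bang_flat_bound[where R = 1 and D = F and L = L])
    show "(F n has_real_derivative F (Suc n) t) (at t)" if "0 \<le> t" "t < 1" for n t
      using deriv[OF that, of n] by (auto simp: F_def intro!: derivative_eq_intros)
    show "\<bar>F n t\<bar> \<le> W n" if t: "0 \<le> t" "t < 1" for n t
      using bound[OF t, of n] bound[of 0 0] K pos[of n] by (auto simp: F_def W_def)
    show "F n 0 = 0" for n using flat by (simp add: F_def)
    have "(\<Sum>j\<in>{N<..L}. 1 / seq_ratio W j) = (\<Sum>j\<in>{N<..L}. 1 / \<mu> j) / K"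
      unfolding sum_divide_distrib by (intro sum.cong) (auto simp: ratio)
    then show "x \<le> (\<Sum>j\<in>{N<..L}. 1 / seq_ratio W j) / exp 1"
      using x by (simp add: mult.commute)
  qed (use x in auto)
  then show ?thesis by (simp add: F_def W_def mult_ac)
qed

lemma bang_flat_two_sided:
  fixes D :: "nat \<Rightarrow> real \<Rightarrow> real"
  assumes K: "0 < K"
    and deriv: "\<And>n t. \<bar>t\<bar> < 1 \<Longrightarrow> (D n has_real_derivative D (Suc n) t) (at t)"
    and bound: "\<And>n t. \<bar>t\<bar> < 1 \<Longrightarrow> \<bar>D n t\<bar> \<le> K ^ (n + 1) * M n"
    and flat: "\<And>n. 0 < n \<Longrightarrow> D n 0 = 0"
    and x: "N \<le> L" "\<bar>x\<bar> < 1" "\<bar>x\<bar> \<le> (\<Sum>j\<in>{N<..L}. 1 / \<mu> j) / (exp 1 * K)"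
  shows "\<bar>D 0 x - D 0 0\<bar> \<le> 2 * K * M 0 * exp (- real N)"
proof (cases "0 \<le> x")
  case True
  then show ?thesis
    using x by (intro bang_flat_scaled[OF K deriv bound flat]) auto
next
  case False
  define D' where "D' n t = (-1) ^ n * D n (- t)" for n t
  have "\<bar>D' 0 (- x) - D' 0 0\<bar> \<le> 2 * K * M 0 * exp (- real N)"
  proof (rule bang_flat_scaled[OF K])
    show "(D' n has_real_derivative D' (Suc n) t) (at t)" if "0 \<le> t" "t < 1" for n t
      unfolding D'_def[abs_def] using that by (intro reflected_derivatives[where R = 1] deriv) auto
    show "\<bar>D' n t\<bar> \<le> K ^ (n + 1) * M n" if "0 \<le> t" "t < 1" for n t
      using bound[of "- t" n] that by (simp add: D'_def abs_mult)
  qed (use x False flat in \<open>auto simp: D'_def\<close>)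
  then show ?thesis by (simp add: D'_def)
qed

text \<open>
  Any level is reached on all of \<open>{-1<..<1}\<close>, so \<open>D 0\<close> is constant there. The folded integrand then vanishes up to
  \<open>1/2\<close>, and the remaining range contributes at most \<open>2 ln 2\<close>.
\<close>

lemma flat_quasianalytic_bounded:
  fixes D :: "nat \<Rightarrow> real \<Rightarrow> real"
  assumes cont: "continuous_on {-1..1} (D 0)" and K: "0 < K"
    and deriv: "\<And>n t. \<bar>t\<bar> < 1 \<Longrightarrow> (D n has_real_derivative D (Suc n) t) (at t)"
    and bound: "\<And>n t. \<bar>t\<bar> < 1 \<Longrightarrow> \<bar>D n t\<bar> \<le> K ^ (n + 1) * M n"
    and flat: "\<And>n. 0 < n \<Longrightarrow> D n 0 = 0"
    and inf: "tail_sum M 1 = \<infinity>" and lam: "0 < lam"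
  shows "norm (pv_osc_integral (D 0) lam) \<le> 2 * ln 2"
proof -
  have const: "D 0 t = D 0 0" if t: "\<bar>t\<bar> < 1" for t
  proof -
    have "\<bar>D 0 t - D 0 0\<bar> \<le> 2 * K * M 0 * exp (- real N)" for N
    proof -
      obtain L where L: "N \<le> L" "exp 1 * K \<le> (\<Sum>j\<in>{N<..L}. 1 / \<mu> j)"
        using divergent_ratio_sum[OF inf] by blast
      then have "1 \<le> (\<Sum>j\<in>{N<..L}. 1 / \<mu> j) / (exp 1 * K)"
        using K by simp
      with t L show ?thesis by (intro bang_flat_two_sided[OF K deriv bound flat]) auto
    qed
    moreover have "(\<lambda>N. 2 * K * M 0 * exp (- real N)) \<longlonglongrightarrow> 2 * K * M 0 * 0"
      by (intro tendsto_mult tendsto_const filterlim_compose[OF exp_at_bot]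
          filterlim_compose[OF filterlim_uminus_at_bot_at_top filterlim_real_sequentially])
    ultimately have "\<bar>D 0 t - D 0 0\<bar> \<le> 2 * K * M 0 * 0"
      by (intro tendsto_lowerbound[where F = sequentially]) auto
    then show ?thesis by simp
  qed
  have "norm (pv_osc_integral (D 0) lam) \<le> 2 * 0 / 1 + norm (truncated_osc_integral (D 0) lam (1 / 2))"
  proof (rule norm_pv_osc_integral_le[OF cont, where \<alpha> = 1])
    show "D 0 differentiable at 0"
      using deriv[of 0 0] real_differentiable_def by auto
    show "lam * \<bar>D 0 t - D 0 0\<bar> \<le> 0 * (\<bar>t\<bar> / (1 / 2)) powr 1" if "\<bar>t\<bar> \<le> 1 / 2" for t
    proof -
      have "D 0 t = D 0 0" using that by (intro const) simp
      then show ?thesis by simp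
    qed
  qed (use lam in auto)
  then show ?thesis
    using norm_truncated_osc_integral_le[OF cont, of "1 / 2" lam] by simp
qed

text \<open>
  With \<open>a = \<kappa> rest (N + 1)\<close>, a point with \<open>\<kappa> rest (N + m + 1) < \<bar>t\<bar> \<le> \<kappa> rest (N + m)\<close> satisfies
  \<open>lam \<bar>D 0 t - D 0 0\<bar> = O(exp (-m))\<close> by Bang's bound, and \<open>\<bar>t\<bar> / a \<ge> q ^ m\<close> because the tails decay at most
  geometrically. The exponent \<open>\<alpha> = 1 / ln (1 / q)\<close> is the one for which \<open>(q ^ m) powr \<alpha> = exp (-m)\<close>.
\<close>

lemma flat_nonquasianalytic_bound:
  fixes D :: "nat \<Rightarrow> real \<Rightarrow> real"
  assumes cont: "continuous_on {-1..1} (D 0)" and K: "0 < K"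
    and deriv: "\<And>n t. \<bar>t\<bar> < 1 \<Longrightarrow> (D n has_real_derivative D (Suc n) t) (at t)"
    and bound: "\<And>n t. \<bar>t\<bar> < 1 \<Longrightarrow> \<bar>D n t\<bar> \<le> K ^ (n + 1) * M n"
    and flat: "\<And>n. 0 < n \<Longrightarrow> D n 0 = 0"
    and fin: "tail_sum M 1 < \<infinity>"
    and q: "0 < q" "q < 1" and N\<^sub>0: "1 \<le> N\<^sub>0" "rest N\<^sub>0 \<le> 1"
    and slow: "\<And>N. N\<^sub>0 \<le> N \<Longrightarrow> q * rest N \<le> rest (Suc N)"
  obtains C where "\<And>N lam. N\<^sub>0 \<le> N \<Longrightarrow> 0 < lam \<Longrightarrow> lam \<le> exp (real N) \<Longrightarrow>
      norm (pv_osc_integral (D 0) lam) \<le> C + 2 * ln (1 / rest N)"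
proof -
  \<comment> \<open>The \<open>3 > e\<close> gives the strict inequality that allows the tail to be replaced by a partial sum; the \<open>1/2\<close> keeps \<open>a < 1\<close>.\<close>
  define \<kappa> where "\<kappa> = min (1 / 2) (1 / (3 * K))"
  have \<kappa>: "0 < \<kappa>" "\<kappa> \<le> 1 / 2" "\<kappa> \<le> 1 / (3 * K)" using K by (auto simp: \<kappa>_def)
  define \<alpha> where "\<alpha> = 1 / ln (1 / q)"
  have \<alpha>: "0 < \<alpha>" using q by (simp add: \<alpha>_def)
  define A where "A = 2 * K * M 0 * exp 1"
  have A0: "0 \<le> A" using K pos[of 0] by (simp add: A_def)
  note rpos = rest_pos[OF fin]
  have small: "\<bar>D 0 t - D 0 0\<bar> \<le> 2 * K * M 0 * exp (- real n)"
    if t: "\<bar>t\<bar> \<le> \<kappa> * rest (Suc n)" "\<bar>t\<bar> < 1" for t n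
  proof (cases "t = 0")
    case True
    then show ?thesis using K pos[of 0] by simp
  next
    case False
    have "\<bar>t\<bar> * (exp 1 * K) < \<bar>t\<bar> * (3 * K)"
      using exp_le False K e_less_272 by (intro mult_strict_left_mono mult_strict_right_mono) auto
    also have "\<dots> \<le> (1 / (3 * K) * rest (Suc n)) * (3 * K)"
      using t(1) \<kappa>(3) rpos[of "Suc n"] K
      by (intro mult_right_mono order_trans[OF t(1)]) auto
    also have "\<dots> = rest (Suc n)" using K by simp
    finally obtain L where L: "n \<le> L" "\<bar>t\<bar> * (exp 1 * K) \<le> (\<Sum>j\<in>{n<..L}. 1 / \<mu> j)"
      using less_rest_imp_partial_sum[OF fin] by blast
    then show ?thesis
      using K t by (intro bang_flat_two_sided[OF K deriv bound flat]) (auto simp: pos_le_divide_eq)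
  qed
  have power_rest: "q ^ m * rest (Suc N) \<le> rest (Suc (N + m))" if "N\<^sub>0 \<le> N" for N m
  proof (induction m)
    case (Suc m)
    have "q * (q ^ m * rest (Suc N)) \<le> q * rest (Suc (N + m))"
      using Suc q by (intro mult_left_mono) auto
    also have "\<dots> \<le> rest (Suc (N + Suc m))" using slow[of "Suc (N + m)"] that by simp
    finally show ?case by (simp add: mult.assoc)
  qed simp
  have "norm (pv_osc_integral (D 0) lam) \<le> (2 * A / \<alpha> + 2 * ln (1 / (\<kappa> * q))) + 2 * ln (1 / rest N)"
    if N: "N\<^sub>0 \<le> N" and lam: "0 < lam" "lam \<le> exp (real N)" for N lam
  proof -
    define a where "a = \<kappa> * rest (Suc N)"
    have "rest (Suc N) \<le> 1"
      using rest_antimono[OF fin, of N\<^sub>0 "Suc N"] N N\<^sub>0 by simp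
    then have "a \<le> 1 / 2 * 1"
      unfolding a_def using \<kappa> rpos[of "Suc N"] by (intro mult_mono) auto
    then have a: "0 < a" "a < 1" using \<kappa> rpos[of "Suc N"] by (auto simp: a_def)
    have "norm (pv_osc_integral (D 0) lam) \<le> 2 * A / \<alpha> + norm (truncated_osc_integral (D 0) lam a)"
    proof (rule norm_pv_osc_integral_le[OF cont])
      show "D 0 differentiable at 0"
        using deriv[of 0 0] real_differentiable_def by auto
      fix t :: real assume t: "\<bar>t\<bar> \<le> a"
      show "lam * \<bar>D 0 t - D 0 0\<bar> \<le> A * (\<bar>t\<bar> / a) powr \<alpha>"
      proof (cases "t = 0")
        case False
        have "(\<lambda>m. \<kappa> * rest (m + Suc N)) \<longlonglongrightarrow> \<kappa> * 0"
          by (intro tendsto_mult tendsto_const LIMSEQ_ignore_initial_segment rest_tendsto_0[OF fin])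
        then have "eventually (\<lambda>m. \<kappa> * rest (m + Suc N) < \<bar>t\<bar>) sequentially"
          using False by (intro order_tendstoD(2)) auto
        then have ex: "\<exists>m. \<kappa> * rest (Suc (N + m)) < \<bar>t\<bar>"
          by (auto simp: eventually_sequentially add.commute)
        \<comment> \<open>The least \<open>m\<close> locates \<open>\<bar>t\<bar>\<close> between two consecutive scaled tails; \<open>m \<noteq> 0\<close> because \<open>\<bar>t\<bar> \<le> a\<close>.\<close>
        define m where "m = (LEAST m. \<kappa> * rest (Suc (N + m)) < \<bar>t\<bar>)"
        have m: "\<kappa> * rest (Suc (N + m)) < \<bar>t\<bar>" unfolding m_def by (rule LeastI_ex[OF ex])
        then have "m \<noteq> 0" using t by (intro notI) (simp add: a_def)
        then obtain l where l: "m = Suc l" using not0_implies_Suc by blast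
        have tl: "\<bar>t\<bar> \<le> \<kappa> * rest (Suc (N + l))"
          using not_less_Least[of l "\<lambda>m. \<kappa> * rest (Suc (N + m)) < \<bar>t\<bar>"] l by (auto simp: m_def)
        have "lam * \<bar>D 0 t - D 0 0\<bar> \<le> exp (real N) * (2 * K * M 0 * exp (- real (N + l)))"
          using lam small[OF tl] t a by (intro mult_mono) auto
        also have "\<dots> = A * exp (- real m)"
          by (simp add: A_def l exp_add exp_diff exp_minus field_simps)
        also have "exp (- real m) = (q ^ m) powr \<alpha>"
          using q by (simp add: powr_def \<alpha>_def ln_div ln_realpow)
        also have "\<dots> \<le> (\<bar>t\<bar> / a) powr \<alpha>"
        proof (intro powr_mono2)
          have "\<kappa> * (q ^ m * rest (Suc N)) \<le> \<kappa> * rest (Suc (N + m))"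
            using power_rest[OF N, of m] \<kappa> by (intro mult_left_mono) auto
          then have "q ^ m * a \<le> \<bar>t\<bar>" using m by (simp add: a_def mult_ac)
          then show "q ^ m \<le> \<bar>t\<bar> / a" using a by (simp add: field_simps)
        qed (use \<alpha> q in auto)
        finally show ?thesis using A0 by (simp add: mult_left_mono)
      qed (use A0 in auto)
    qed (use lam a \<alpha> A0 in auto)
    moreover have "norm (truncated_osc_integral (D 0) lam a) \<le> 2 * ln (1 / a)"
      using a by (intro norm_truncated_osc_integral_le[OF cont]) auto
    moreover have "ln (1 / a) \<le> ln (1 / (\<kappa> * q)) + ln (1 / rest N)"
    proof -
      have r: "0 < rest N" using rpos[of N] N N\<^sub>0 by simp
      have "\<kappa> * (q * rest N) \<le> a"
        unfolding a_def using slow[OF N] \<kappa> by (intro mult_left_mono) auto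
      then have "ln (1 / a) \<le> ln (1 / (\<kappa> * (q * rest N)))"
        using a \<kappa> q r by (simp add: ln_div)
      then show ?thesis using \<kappa> q r by (simp add: ln_div ln_mult)
    qed
    ultimately show ?thesis by simp
  qed
  then show ?thesis by (rule that)
qed

end

section \<open>The bound for the principal value integral\<close>

lemma nth_deriv_within_has_derivative:
  assumes "C_infinity_on {-1..1} f" "\<bar>t\<bar> < 1"
  shows "(nth_deriv_within {-1..1} n f has_real_derivative nth_deriv_within {-1..1} (Suc n) f t) (at t)"
proof -
  have "at t within {-1..1} = at t"
    using assms(2) by (intro at_within_Icc_at) auto
  moreover have "nth_deriv_within {-1..1} n f differentiable (at t within {-1..1})"
    using assms by (auto simp: C_infinity_on_def differentiable_on_def abs_less_iff)
  ultimately show ?thesis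
    by (simp add: has_real_derivative_iff_has_vector_derivative vector_derivative_works)
qed

theorem theorem4p1:
  fixes M :: "nat \<Rightarrow> real" and \<psi> :: "real \<Rightarrow> real"
  assumes "\<And>n. 0 < M n" and "log_convex_seq M" and "M 0 = 1"
    and "\<psi> \<in> denjoy_carleman M {-1..1}"
  shows "(tail_sum M 1 = \<infinity> \<longrightarrow> pv_osc_integral \<psi> \<in> O[at_top](\<lambda>_. 1)) \<and>
    (tail_sum M 1 < \<infinity> \<longrightarrow>
     (\<exists>C\<^sub>0>1. eventually (\<lambda>N. ennreal C\<^sub>0 \<le> ennreal (seq_ratio M N) * tail_sum M (real N)) sequentially) \<longrightarrow>
     (\<exists>C>0. \<exists>c>0. \<forall>lam\<ge>2.
        norm (pv_osc_integral \<psi> lam) \<le> C * (1 + ln (1 / enn2real (tail_sum M (c * ln lam))))))"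
proof -
  interpret log_convex_weights M using assms(1,2) by unfold_locales
  define D where "D n = nth_deriv_within {-1..1} n \<psi>" for n
  obtain K where K: "0 < K" and bd: "\<And>n t. t \<in> {-1..1} \<Longrightarrow> \<bar>D n t\<bar> \<le> K ^ (n + 1) * M n"
    and smooth: "C_infinity_on {-1..1} \<psi>"
    using assms(4) unfolding denjoy_carleman_def D_def by blast
  have D0: "D 0 = \<psi>" by (simp add: D_def)
  have deriv: "(D n has_real_derivative D (Suc n) t) (at t)" if "\<bar>t\<bar> < 1" for n t
    unfolding D_def by (rule nth_deriv_within_has_derivative[OF smooth that])
  have bound: "\<bar>D n t\<bar> \<le> K ^ (n + 1) * M n" if "\<bar>t\<bar> < 1" for n t
    using bd[of t n] that by (auto simp: abs_less_iff)
  have cont: "continuous_on {-1..1} (D 0)"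
    using smooth unfolding C_infinity_on_def D_def by (blast intro: differentiable_imp_continuous_on)
  consider (finite_order) n where "0 < n" "D n 0 \<noteq> 0" | (flat) "\<And>n. 0 < n \<Longrightarrow> D n 0 = 0" by blast
  then have quasi: "\<exists>C. \<forall>lam\<ge>1. norm (pv_osc_integral \<psi> lam) \<le> C" if "tail_sum M 1 = \<infinity>"
  proof cases
    case finite_order
    then show ?thesis
      using finite_order_imp_bounded[OF cont refl deriv bound] unfolding D0 by metis
  next
    case flat
    then show ?thesis
      using flat_quasianalytic_bounded[OF cont K deriv bound flat that] unfolding D0
      by (intro exI[of _ "2 * ln 2"]) auto
  qed
  have part1: "pv_osc_integral \<psi> \<in> O[at_top](\<lambda>_. 1)" if inf: "tail_sum M 1 = \<infinity>"
  proof -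
    from quasi[OF inf] obtain C where C: "\<And>lam. 1 \<le> lam \<Longrightarrow> norm (pv_osc_integral \<psi> lam) \<le> C" by blast
    show ?thesis
      by (rule bigoI[of _ C], rule eventually_mono[OF eventually_ge_at_top[of 1]]) (use C in auto)
  qed
  have part2: "\<exists>C>0. \<exists>c>0. \<forall>lam\<ge>2.
        norm (pv_osc_integral \<psi> lam) \<le> C * (1 + ln (1 / enn2real (tail_sum M (c * ln lam))))"
    if fin: "tail_sum M 1 < \<infinity>" and C\<^sub>0: "1 < C\<^sub>0"
      and ev: "eventually (\<lambda>N. ennreal C\<^sub>0 \<le> ennreal (seq_ratio M N) * tail_sum M (real N)) sequentially"
    for C\<^sub>0
  proof -
    note rpos = rest_pos[OF fin]
    have "eventually (\<lambda>N. rest N < 1) sequentially"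
      using rest_tendsto_0[OF fin] by (intro order_tendstoD(2)) auto
    with ev have "eventually (\<lambda>N. 1 \<le> N \<and> rest N < 1 \<and>
        ennreal C\<^sub>0 \<le> ennreal (\<mu> N) * tail_sum M (real N)) sequentially"
      using eventually_ge_at_top[of 1] by eventually_elim auto
    \<comment> \<open>Beyond \<open>N\<^sub>0\<close> the tails are also below \<open>1\<close>, which makes \<open>ln (1 / rest N)\<close> nonnegative.\<close>
    then obtain N\<^sub>0 where N\<^sub>0: "\<And>N. N\<^sub>0 \<le> N \<Longrightarrow> 1 \<le> N \<and> rest N < 1 \<and>
        ennreal C\<^sub>0 \<le> ennreal (\<mu> N) * tail_sum M (real N)"
      unfolding eventually_sequentially by blast
    have slow: "(1 - 1 / C\<^sub>0) * rest N \<le> rest (Suc N)" if N: "N\<^sub>0 \<le> N" for N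
    proof -
      have N1: "1 \<le> N" using N\<^sub>0[OF N] by simp
      have "ennreal C\<^sub>0 \<le> ennreal (\<mu> N * rest N)"
        using N\<^sub>0[OF N] ratio_pos[of N] rpos[OF N1] tail_sum_eq_rest[OF fin N1]
        by (simp add: ennreal_mult less_imp_le)
      then have "C\<^sub>0 \<le> \<mu> N * rest N"
        using ratio_pos[of N] rpos[OF N1] by (simp add: ennreal_le_iff less_imp_le)
      then have "1 / \<mu> N \<le> rest N / C\<^sub>0"
        using ratio_pos[of N] C\<^sub>0 by (simp add: field_simps)
      then show ?thesis using rest_Suc[OF fin N1] by (simp only: left_diff_distrib) simp
    qed
    obtain C1 where C1: "\<And>N lam. N\<^sub>0 \<le> N \<Longrightarrow> 1 \<le> lam \<Longrightarrow> lam \<le> exp (real N) \<Longrightarrow>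
      norm (pv_osc_integral \<psi> lam) \<le> C1 + 2 * ln (1 / rest N)"
    proof -
      consider (finite_order) n where "0 < n" "D n 0 \<noteq> 0" | (flat) "\<And>n. 0 < n \<Longrightarrow> D n 0 = 0" by blast
      then show ?thesis
      proof cases
        case finite_order
        then obtain C where C: "\<And>lam. 1 \<le> lam \<Longrightarrow> norm (pv_osc_integral \<psi> lam) \<le> C"
          using finite_order_imp_bounded[OF cont refl deriv bound] unfolding D0 by metis
        show ?thesis
        proof (rule that[of C])
          fix N and lam :: real assume N: "N\<^sub>0 \<le> N" and lam: "1 \<le> lam"
          have "0 \<le> ln (1 / rest N)" using N\<^sub>0[OF N] rpos[of N] by simp
          then show "norm (pv_osc_integral \<psi> lam) \<le> C + 2 * ln (1 / rest N)"
            using C[OF lam] by simp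
        qed
      next
        case flat
        obtain C where "\<And>N lam. N\<^sub>0 \<le> N \<Longrightarrow> 0 < lam \<Longrightarrow> lam \<le> exp (real N) \<Longrightarrow>
            norm (pv_osc_integral (D 0) lam) \<le> C + 2 * ln (1 / rest N)"
          by (rule flat_nonquasianalytic_bound[OF cont K deriv bound flat fin _ _ _ _ slow])
            (use C\<^sub>0 N\<^sub>0[of N\<^sub>0] in auto)
        then show ?thesis using that[of C] by (simp add: D0)
      qed
    qed
    define C where "C = max 2 C1"
    \<comment> \<open>\<open>c \<ge> 1\<close> gives \<open>lam \<le> exp N\<close> for \<open>N \<ge> c ln lam\<close>; \<open>c ln 2 \<ge> N\<^sub>0\<close> puts every \<open>lam \<ge> 2\<close> into the range \<open>N \<ge> N\<^sub>0\<close>.\<close>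
    define c where "c = max 1 (real N\<^sub>0 / ln 2)"
    have C: "0 < C" "C1 \<le> C" "2 \<le> C" by (auto simp: C_def)
    have c: "1 \<le> c" "real N\<^sub>0 \<le> c * ln 2" by (auto simp: c_def max_def field_simps)
    have "norm (pv_osc_integral \<psi> lam) \<le> C * (1 + ln (1 / enn2real (tail_sum M (c * ln lam))))"
      if lam: "2 \<le> lam" for lam
    proof -
      define N where "N = nat \<lceil>c * ln lam\<rceil>"
      have pos: "0 < c * ln lam" using lam c by simp
      have "c * ln 2 \<le> c * ln lam" using lam c by (intro mult_left_mono) auto
      then have "real N\<^sub>0 \<le> real N"
        using c real_nat_ceiling_ge[of "c * ln lam"] unfolding N_def by linarith
      then have N: "N\<^sub>0 \<le> N" by simp
      have "1 * ln lam \<le> c * ln lam" using lam c by (intro mult_right_mono) auto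
      then have "ln lam \<le> real N"
        using real_nat_ceiling_ge[of "c * ln lam"] unfolding N_def by linarith
      then have "lam \<le> exp (real N)" using lam by (metis exp_ge_zero exp_le_cancel_iff exp_ln less_le_trans zero_less_numeral)
      then have "norm (pv_osc_integral \<psi> lam) \<le> C1 + 2 * ln (1 / rest N)"
        using C1[OF N] lam by simp
      also have "\<dots> \<le> C + C * ln (1 / rest N)"
        using C N\<^sub>0[OF N] rpos[of N] by (intro add_mono mult_right_mono) auto
      also have "rest N = enn2real (tail_sum M (c * ln lam))"
        using tail_sum_nat_ceiling[OF pos] tail_sum_eq_rest[OF fin, of N] N\<^sub>0[OF N] rpos[of N]
        by (simp add: N_def less_imp_le)
      finally show ?thesis by (simp add: distrib_left)
    qed
    then show ?thesis using C c by (intro exI[of _ C] exI[of _ c] conjI) auto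
  qed
  show ?thesis using part1 part2 by blast
qed

end
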